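(* Let $d\ge 1$ and $1<p<\infty$. There exist constants $C(s,d,p)>0$ (depending only on $s\in\mathbb{N}$, $d$ and $p$) such that the following holds. Let $P\subset\mathbb{R}^d$ be a bounded convex polyhedron such that $P\subset[0,n_1]\times\dots\times[0,n_d]$, where $n_1,\dots,n_d$ are real numbers with $n_j\ge1$ for $j=1,\dots,d$, and let $s$ be the size of a triangulation of $P$. Then $$\mathcal{L}(P)_p\le C(s,d,p)\prod_{j=1}^d(n_j+1)^{1-\frac1p}.$$ Moreover, as $\min_{j=1,\dots,d}n_j\to\infty$ the constant may be taken to be at most $C(d,p)s$; that is, there are a constant $C(d,p)>0$ depending only on $d$ and $p$ and, for each $s\in\mathbb{N}$, a number $N_0(s,d,p)$ such that, for every such $P$ and $n_1,\dots,n_d$ with $\min_j n_j\ge N_0(s,d,p)$, $$\mathcal{L}(P)_p\le C(d,p)\,s\prod_{j=1}^d(n_j+1)^{1-\frac1p}.$$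
   Context: For a bounded set $W\subset\mathbb{R}^d$ the $L_p$ Lebesgue constant is $$\mathcal{L}(W)_p=\left(\frac{1}{(2\pi)^d}\int_{\mathbb{T}^d}\bigg|\sum_{\bm{k}\in W\cap\mathbb{Z}^d}e^{i(\bm{k},\bm{x})}\bigg|^p\,d\bm{x}\right)^{1/p},\qquad \mathbb{T}^d\simeq(-\pi,\pi]^d,$$ where $(\bm{k},\bm{x})=k_1x_1+\dots+k_dx_d$ and an empty sum is $0$. A triangulation of a convex polyhedron $P$ is a representation of $P$ as a finite union of tetrahedra (simplices) $T_1,\dots,T_s$ such that for $i\ne j$ the intersection $T_i\cap T_j$ is either empty or a face of both; its size is the number $s$ of simplices. *)

theory Defs
  imports "HOL-Analysis.Analysis"
begin

definition lattice_points :: "(real ^ 'n) set \<Rightarrow> (real ^ 'n) set" where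
  "lattice_points W = {k \<in> W. \<forall>j. k $ j \<in> \<int>}"

definition torus_box :: "(real ^ 'n) set" where
  "torus_box = {x. \<forall>j. - pi < x $ j \<and> x $ j \<le> pi}"

(* Meant for bounded W only: otherwise lattice_points W may be infinite, and the
   sum over an infinite set is 0 by convention. *)
definition Lebesgue_const :: "real \<Rightarrow> (real ^ 'n::finite) set \<Rightarrow> real" where
  "Lebesgue_const p W =
     (1 / (2 * pi) ^ CARD('n) *
       (LINT x:torus_box|lborel.
          cmod (\<Sum>k\<in>lattice_points W. exp (\<i> * complex_of_real (k \<bullet> x))) powr p))
     powr (1 / p)"

(* The library's triangulation does not name the triangulated set and admits the
   empty set as the simplex of dimension -1; the latter is excluded here.
   Simplices may have any dimension from 0 to that of the ambient space. *)
definition triangulation_of :: "'a::euclidean_space set set \<Rightarrow> 'a set \<Rightarrow> bool" where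
  "triangulation_of T P \<longleftrightarrow> triangulation T \<and> {} \<notin> T \<and> \<Union>T = P"

definition has_triangulation_of_size :: "'a::euclidean_space set \<Rightarrow> nat \<Rightarrow> bool" where
  "has_triangulation_of_size P s \<longleftrightarrow> (\<exists>T. triangulation_of T P \<and> card T = s)"

end

theory Submission
  imports Defs
begin

text \<open>Write \<open>N\<close> for the product of the numbers \<open>n $ j + 1\<close>, which bounds the number of lattice points of \<open>P\<close>,
and \<open>D\<close> for the exponential sum over these points. A bound for a single exponent \<open>q\<close> with
\<open>1 < q \<le> p\<close> suffices, because \<open>cmod D \<le> N\<close> gives
\<open>cmod D powr p \<le> N powr (p - q) * cmod D powr q\<close>. The exponent is chosen as
\<open>q = 2 * m / (2 * m - 1)\<close>, conjugate to the even integer \<open>2 * m\<close>, where the estimates are algebraic.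

By duality (\<open>dual_norm_bound\<close>, resting on the density of trigonometric polynomials) it is enough to
control, for an arbitrary trigonometric polynomial \<open>f\<close>, the sum of its coefficients over the lattice
points of \<open>P\<close> by the \<open>2 * m\<close>-norm of \<open>f\<close>. This sum splits over a partition of \<open>P\<close> into relative
interiors of faces of the triangulation (\<open>simplex_minus_faces_cells\<close>); at most
\<open>2 ^ (d + 1)\<close> of them are needed per simplex, where \<open>d\<close> is the dimension of the space, and this is where
linearity in \<open>s\<close> comes from.

A single cell is an intersection of at most \<open>2 * (d + 1)\<close> half-spaces. Restricting the spectrum of
\<open>f\<close> to a half-space is bounded in the \<open>2 * m\<close>-norm by a constant independent of the half-space
(\<open>halfspace_projection_bounded\<close>): this is M. Riesz's theorem, and for even exponents it follows from a
pointwise inequality together with the vanishing of an integral. After the restriction the spectrum lies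
in the box, and the sum of the coefficients is the value at the origin, bounded by the Nikolskii
inequality \<open>nikolskii_even\<close>. The factor obtained there is \<open>N powr (1 / (2 * m))\<close>, which is
\<open>N powr (1 - 1 / q)\<close>.\<close>

section \<open>The normalised torus and its characters\<close>

lemma integral_lborel_prod:
  fixes f :: "'a::euclidean_space \<Rightarrow> real \<Rightarrow> complex"
  assumes f: "\<And>b. b \<in> Basis \<Longrightarrow> integrable lborel (f b)"
  shows "(\<integral>x. (\<Prod>b\<in>Basis. f b (x \<bullet> b)) \<partial>(lborel :: 'a measure)) = (\<Prod>b\<in>Basis. \<integral>t. f b t \<partial>lborel)"
proof -
  interpret product_sigma_finite "\<lambda>_::'a. lborel :: real measure" ..
  have [measurable]: "\<And>b. b \<in> Basis \<Longrightarrow> f b \<in> borel_measurable borel"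
    using f borel_measurable_integrable by force
  have "(\<integral>x. (\<Prod>b\<in>Basis. f b (x \<bullet> b)) \<partial>(lborel :: 'a measure))
      = (\<integral>y. (\<Prod>b\<in>Basis. f b ((\<Sum>c\<in>Basis. y c *\<^sub>R c) \<bullet> b)) \<partial>(\<Pi>\<^sub>M b\<in>(Basis :: 'a set). lborel))"
    by (subst lborel_eq, subst integral_distr) simp_all
  also have "\<dots> = (\<integral>y. (\<Prod>b\<in>Basis. f b (y b)) \<partial>(\<Pi>\<^sub>M b\<in>(Basis :: 'a set). lborel))"
    by (intro Bochner_Integration.integral_cong refl prod.cong) simp
  also have "\<dots> = (\<Prod>b\<in>Basis. \<integral>t. f b t \<partial>lborel)"
    by (rule product_integral_prod) (use f in auto)
  finally show ?thesis .
qed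

lemma integral_cis_period:
  assumes "n \<in> \<int>"
  shows "has_bochner_integral lborel (\<lambda>t. indicator {-pi<..pi} t *\<^sub>R cis (n * t))
           (if n = 0 then complex_of_real (2 * pi) else 0)"
proof -
  have "has_bochner_integral lborel (\<lambda>t. indicator {-pi..pi} t *\<^sub>R cis (n * t))
           (if n = 0 then complex_of_real (2 * pi) else 0)"
  proof (cases "n = 0")
    case True
    have "has_bochner_integral lborel (\<lambda>t. indicator {-pi..pi} t *\<^sub>R (1::complex)) (measure lborel {-pi..pi} *\<^sub>R 1)"
      by (rule has_bochner_integral_scaleR_left, rule has_bochner_integral_real_indicator) auto
    then show ?thesis using True by (simp add: scaleR_conv_of_real)
  next
    case False
    define F where "F t = cis (n * t) / (\<i> * n)" for t
    have "has_bochner_integral lborel (\<lambda>t. indicator {-pi..pi} t *\<^sub>R cis (n * t)) (F pi - F (-pi))"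
    proof (rule has_bochner_integral_FTC_Icc)
      fix t :: real
      show "(F has_vector_derivative cis (n * t)) (at t within {-pi..pi})"
        unfolding F_def cis_conv_exp of_real_mult
      proof (rule has_vector_derivative_real_field)
        show "((\<lambda>z. exp (\<i> * (complex_of_real n * z)) / (\<i> * complex_of_real n)) has_field_derivative
            exp (\<i> * (complex_of_real n * complex_of_real t))) (at (complex_of_real t))"
          using False by (auto intro!: derivative_eq_intros simp: mult_ac)
      qed
    qed (auto intro!: continuous_intros)
    moreover have "F pi - F (-pi) = 0"
    proof -
      obtain z :: int where "n = z" using assms by (auto elim: Ints_cases)
      then have "cis (2 * pi * n) = 1" using assms by simp
      then have "cis (n * pi) = cis (- n * pi)"
        using cis_mult[of "- n * pi" "2 * pi * n"] by (simp add: algebra_simps)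
      then show ?thesis by (simp add: F_def)
    qed
    ultimately show ?thesis using False by simp
  qed
  moreover have "AE t in lborel. indicator {-pi<..pi} t *\<^sub>R cis (n * t) = indicator {-pi..pi} t *\<^sub>R cis (n * t)"
    using AE_lborel_singleton[of "-pi"] by eventually_elim (auto simp: indicator_def)
  moreover have "(\<lambda>t. cis (n * t)) \<in> borel_measurable borel"
    by (intro borel_measurable_continuous_onI continuous_intros)
  ultimately show ?thesis
    by (subst has_bochner_integral_cong_AE) auto
qed

text \<open>Normalised to total mass one, so that the characters form an orthonormal system and no power
of \<open>2 * pi\<close> appears in the estimates.\<close>

definition torus_measure :: "(real ^ 'n::finite) measure" where
  "torus_measure = density lborel (\<lambda>x. indicator torus_box x / (2 * pi) ^ CARD('n))"

lemma indicator_torus_box: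
  "indicator torus_box x = (\<Prod>b\<in>Basis. indicator {-pi<..pi} (x \<bullet> b) :: real)" for x :: "real ^ 'n::finite"
proof -
  have *: "x \<in> torus_box \<longleftrightarrow> (\<forall>b\<in>Basis. x \<bullet> b \<in> {-pi<..pi})"
    by (auto simp: torus_box_def Basis_vec_def inner_axis)
  show ?thesis
  proof (cases "x \<in> torus_box")
    case True
    with * show ?thesis by (auto simp: indicator_def intro!: prod.neutral[symmetric])
  next
    case False
    with * obtain b where "b \<in> Basis" "x \<bullet> b \<notin> {-pi<..pi}" by auto
    then have "(\<Prod>b\<in>Basis. indicator {-pi<..pi} (x \<bullet> b) :: real) = 0"
      by (intro prod_zero) (auto intro!: bexI[of _ b])
    with False show ?thesis by simp
  qed
qed

lemma torus_box_borel [measurable]: "(torus_box :: (real ^ 'n::finite) set) \<in> sets borel"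
  unfolding torus_box_def by measurable

lemma sets_torus_measure [measurable_cong, simp]: "sets torus_measure = sets borel"
  by (simp add: torus_measure_def)

lemma space_torus_measure [simp]: "space torus_measure = UNIV"
  by (simp add: torus_measure_def)

lemma integral_torus_measure:
  fixes f :: "real ^ 'n::finite \<Rightarrow> 'b::{banach, second_countable_topology}"
  assumes [measurable]: "f \<in> borel_measurable borel"
  shows "(\<integral>x. f x \<partial>torus_measure) = (1 / (2 * pi) ^ CARD('n)) *\<^sub>R (LINT x:torus_box|lborel. f x)"
proof -
  have "(\<integral>x. f x \<partial>torus_measure) = (\<integral>x. (indicator torus_box x / (2 * pi) ^ CARD('n)) *\<^sub>R f x \<partial>lborel)"
    unfolding torus_measure_def by (rule integral_density) auto
  also have "\<dots> = (\<integral>x. (1 / (2 * pi) ^ CARD('n)) *\<^sub>R (indicator torus_box x *\<^sub>R f x) \<partial>lborel)"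
    by (intro Bochner_Integration.integral_cong) auto
  also have "\<dots> = (1 / (2 * pi) ^ CARD('n)) *\<^sub>R (LINT x:torus_box|lborel. f x)"
    unfolding set_lebesgue_integral_def by (rule integral_scaleR_right)
  finally show ?thesis .
qed

lemma inner_vec_Ints: "\<forall>j. k $ j \<in> \<int> \<Longrightarrow> b \<in> Basis \<Longrightarrow> k \<bullet> b \<in> \<int>" for k :: "real ^ 'n::finite"
  by (auto simp: Basis_vec_def inner_axis)

lemma cis_sum: "finite A \<Longrightarrow> cis (\<Sum>a\<in>A. f a) = (\<Prod>a\<in>A. cis (f a))"
  by (induction rule: finite_induct) (auto simp: cis_mult[symmetric])

text \<open>Both the character and the indicator of the torus box are products over the coordinates, so the
integral factors into one-dimensional integrals over a period.\<close>

lemma torus_orthogonality: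
  fixes k :: "real ^ 'n::finite"
  assumes k: "\<forall>j. k $ j \<in> \<int>"
  shows "(\<integral>x. cis (k \<bullet> x) \<partial>torus_measure) = (if k = 0 then 1 else 0)"
proof -
  have one: "has_bochner_integral lborel (\<lambda>t. indicator {-pi<..pi} t *\<^sub>R cis ((k \<bullet> b) * t))
               (if k \<bullet> b = 0 then complex_of_real (2 * pi) else 0)" if "b \<in> Basis" for b
    by (rule integral_cis_period) (use that k inner_vec_Ints in auto)
  have cis_prod: "cis (k \<bullet> x) = (\<Prod>b\<in>Basis. cis ((k \<bullet> b) * (x \<bullet> b)))" for x
    by (subst euclidean_inner) (rule cis_sum, simp)
  have "(LINT x:torus_box|lborel. cis (k \<bullet> x))
      = (\<integral>x. (\<Prod>b\<in>Basis. indicator {-pi<..pi} (x \<bullet> b) *\<^sub>R cis ((k \<bullet> b) * (x \<bullet> b))) \<partial>lborel)"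
    unfolding set_lebesgue_integral_def
    by (intro Bochner_Integration.integral_cong refl)
       (simp add: indicator_torus_box cis_prod prod.distrib scaleR_conv_of_real)
  also have "\<dots> = (\<Prod>b\<in>Basis. (if k \<bullet> b = 0 then complex_of_real (2 * pi) else 0))"
    using one by (subst integral_lborel_prod)
      (auto simp: has_bochner_integral_iff cong: prod.cong)
  also have "\<dots> = (if k = 0 then (2 * pi) ^ CARD('n) else 0)"
  proof (cases "k = 0")
    case False
    then obtain b where "b \<in> Basis" "k \<bullet> b \<noteq> 0" using euclidean_all_zero_iff[of k] by blast
    then show ?thesis using False by (auto intro!: prod_zero)
  qed auto
  finally show ?thesis
    by (subst integral_torus_measure)
       (auto simp: scaleR_conv_of_real intro!: borel_measurable_continuous_onI continuous_intros)
qed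

lemma finite_torus_measure: "finite_measure (torus_measure :: (real ^ 'n::finite) measure)"
proof
  let ?c = "1 / (2 * pi) ^ CARD('n)"
  have sub: "(torus_box :: (real ^ 'n) set) \<subseteq> cbox (\<chi> i. -pi) (\<chi> i. pi)"
    by (auto simp: torus_box_def mem_box_cart less_imp_le)
  have fin: "emeasure lborel (torus_box :: (real ^ 'n) set) < \<infinity>"
    by (rule emeasure_bounded_finite) (rule bounded_subset[OF bounded_cbox sub])
  have "emeasure torus_measure (space (torus_measure :: (real ^ 'n) measure))
      = (\<integral>\<^sup>+x. ennreal ?c * indicator (torus_box :: (real ^ 'n) set) x \<partial>lborel)"
    unfolding torus_measure_def
    by (subst emeasure_density) (auto intro!: nn_integral_cong simp: indicator_def)
  also have "\<dots> = ennreal ?c * emeasure lborel (torus_box :: (real ^ 'n) set)"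
    by (subst nn_integral_cmult) auto
  also have "\<dots> < \<infinity>" using fin by (simp add: ennreal_mult_less_top)
  finally show "emeasure torus_measure (space (torus_measure :: (real ^ 'n) measure)) \<noteq> \<infinity>" by simp
qed

lemma measure_torus [simp]: "measure (torus_measure :: (real ^ 'n::finite) measure) UNIV = 1"
  using torus_orthogonality[of "0 :: real ^ 'n"] by (simp add: scaleR_conv_of_real)

lemma integrable_torus:
  fixes f :: "real ^ 'n::finite \<Rightarrow> 'b::{banach, second_countable_topology}"
  assumes "continuous_on UNIV f" "\<And>x. norm (f x) \<le> B"
  shows "integrable torus_measure f"
proof -
  interpret finite_measure "torus_measure :: (real ^ 'n) measure" by (rule finite_torus_measure)
  show ?thesis
    by (rule integrable_const_bound[of _ B])
       (use assms borel_measurable_continuous_onI in \<open>auto simp: measurable_cong_sets[OF sets_torus_measure refl]\<close>)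
qed

section \<open>Trigonometric polynomials\<close>

definition integer_vectors :: "(real ^ 'n) set" where
  "integer_vectors = {k. \<forall>j. k $ j \<in> \<int>}"

lemma integer_vectors_add: "k \<in> integer_vectors \<Longrightarrow> l \<in> integer_vectors \<Longrightarrow> k + l \<in> integer_vectors"
  and integer_vectors_diff: "k \<in> integer_vectors \<Longrightarrow> l \<in> integer_vectors \<Longrightarrow> k - l \<in> integer_vectors"
  by (auto simp: integer_vectors_def)

text \<open>The finite linear combinations of characters with frequencies in \<open>X\<close>. The inductive form leaves
the coefficients implicit and makes closure under products immediate; \<open>trig_sum\<close> below is the
explicit form, in which discarding frequencies means shrinking the index set.\<close>

inductive trig_poly_on :: "(real ^ 'n::finite) set \<Rightarrow> (real ^ 'n \<Rightarrow> complex) \<Rightarrow> bool" for X where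
  zero: "trig_poly_on X (\<lambda>x. 0)"
| monom: "k \<in> X \<Longrightarrow> trig_poly_on X (\<lambda>x. c * cis (k \<bullet> x))"
| add: "trig_poly_on X f \<Longrightarrow> trig_poly_on X g \<Longrightarrow> trig_poly_on X (\<lambda>x. f x + g x)"

definition trig_sum :: "(real ^ 'n::finite \<Rightarrow> complex) \<Rightarrow> (real ^ 'n) set \<Rightarrow> real ^ 'n \<Rightarrow> complex" where
  "trig_sum c K x = (\<Sum>k\<in>K. c k * cis (k \<bullet> x))"

lemma trig_poly_on_trig_sum:
  assumes "finite K" "K \<subseteq> X"
  shows "trig_poly_on X (trig_sum c K)"
  using assms
proof (induction K rule: finite_induct)
  case empty
  then show ?case by (simp add: trig_sum_def[abs_def] trig_poly_on.zero)
next
  case (insert k K)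
  then have "trig_poly_on X (\<lambda>x. c k * cis (k \<bullet> x) + trig_sum c K x)"
    by (intro trig_poly_on.intros) auto
  then show ?case using insert by (simp add: trig_sum_def[abs_def])
qed

lemma trig_poly_on_mult:
  assumes f: "trig_poly_on X f" and g: "trig_poly_on Y g"
    and XY: "\<And>k l. k \<in> X \<Longrightarrow> l \<in> Y \<Longrightarrow> k + l \<in> Z"
  shows "trig_poly_on Z (\<lambda>x. f x * g x)"
  using f
proof induction
  case (monom k c)
  show ?case using g
  proof induction
    case (monom l d)
    have "trig_poly_on Z (\<lambda>x. (c * d) * cis ((k + l) \<bullet> x))"
      using XY \<open>k \<in> X\<close> monom by (intro trig_poly_on.intros) auto
    then show ?case by (simp add: inner_add_left cis_mult[symmetric] mult_ac)
  qed (auto simp: distrib_left intro: trig_poly_on.intros)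
qed (auto simp: distrib_right intro: trig_poly_on.intros)

lemma trig_poly_on_cnj:
  assumes "trig_poly_on X f" and X: "\<And>k. k \<in> X \<Longrightarrow> - k \<in> Y"
  shows "trig_poly_on Y (\<lambda>x. cnj (f x))"
  using assms(1)
proof induction
  case (monom k c)
  then show ?case using trig_poly_on.monom[OF X, of k "cnj c"] by (simp add: cis_cnj)
qed (auto intro: trig_poly_on.intros)

lemma trig_poly_on_power:
  assumes "trig_poly_on X f" and "\<And>k l. k \<in> X \<Longrightarrow> l \<in> X \<Longrightarrow> k + l \<in> X"
  shows "trig_poly_on X (\<lambda>x. f x ^ Suc m)"
proof (induction m)
  case (Suc m)
  show ?case using trig_poly_on_mult[OF assms(1) Suc assms(2)] by simp
qed (use assms in simp)

lemma trig_poly_on_mono: "trig_poly_on X f \<Longrightarrow> X \<subseteq> Y \<Longrightarrow> trig_poly_on Y f"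
  by (induction rule: trig_poly_on.induct) (auto intro: trig_poly_on.intros)

lemma trig_poly_on_eq_trig_sum:
  assumes "trig_poly_on X f" "finite X"
  obtains c where "f = trig_sum c X"
proof -
  have "\<exists>c. f = trig_sum c X" using assms(1)
  proof induction
    case zero
    show ?case by (rule exI[of _ "\<lambda>_. 0"]) (simp add: trig_sum_def[abs_def])
  next
    case (monom k c)
    have "(\<Sum>l\<in>X. (if l = k then c else 0) * cis (l \<bullet> x)) = c * cis (k \<bullet> x)" for x
      using monom assms(2) by (subst sum.mono_neutral_right[of X "{k}"]) auto
    then show ?case
      by (intro exI[of _ "\<lambda>l. if l = k then c else 0"]) (simp add: trig_sum_def[abs_def])
  next
    case (add f g)
    then obtain c d where "f = trig_sum c X" "g = trig_sum d X" by blast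
    then show ?case
      by (intro exI[of _ "\<lambda>k. c k + d k"]) (simp add: trig_sum_def[abs_def] distrib_right sum.distrib)
  qed
  with that show thesis by blast
qed

lemma trig_poly_on_finite:
  assumes "trig_poly_on X f"
  obtains K where "finite K" "K \<subseteq> X" "trig_poly_on K f"
proof -
  have "\<exists>K. finite K \<and> K \<subseteq> X \<and> trig_poly_on K f" using assms
  proof induction
    case (monom k c)
    then show ?case by (intro exI[of _ "{k}"]) (auto intro: trig_poly_on.intros)
  next
    case (add f g)
    then obtain K L where "finite K" "K \<subseteq> X" "trig_poly_on K f" "finite L" "L \<subseteq> X" "trig_poly_on L g"
      by blast
    then show ?case
      by (intro exI[of _ "K \<union> L"] conjI trig_poly_on.add) (auto intro: trig_poly_on_mono)
  qed (auto intro: trig_poly_on.intros)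
  with that show thesis by blast
qed

lemma continuous_trig_sum [continuous_intros]:
  "continuous_on A f \<Longrightarrow> continuous_on A (\<lambda>x. trig_sum c K (f x))"
  unfolding trig_sum_def by (intro continuous_intros)

lemma norm_trig_sum_le: "cmod (trig_sum c K x) \<le> (\<Sum>k\<in>K. cmod (c k))"
  unfolding trig_sum_def by (rule order_trans[OF norm_sum]) (simp add: norm_mult)

lemma trig_poly_on_continuous_bounded:
  assumes "trig_poly_on X f"
  shows "continuous_on UNIV f" "\<exists>B. \<forall>x. cmod (f x) \<le> B"
proof -
  obtain K where K: "finite K" "trig_poly_on K f" using trig_poly_on_finite[OF assms] by blast
  then obtain c where f: "f = trig_sum c K" using trig_poly_on_eq_trig_sum by blast
  show "continuous_on UNIV f" "\<exists>B. \<forall>x. cmod (f x) \<le> B"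
    unfolding f using norm_trig_sum_le[of c K] by (auto intro!: continuous_intros)
qed

lemma trig_poly_on_integrable: "trig_poly_on X f \<Longrightarrow> integrable torus_measure f"
  using trig_poly_on_continuous_bounded integrable_torus by metis

lemma trig_poly_on_integral_zero:
  assumes "trig_poly_on X f" "X \<subseteq> integer_vectors" "0 \<notin> X"
  shows "(\<integral>x. f x \<partial>torus_measure) = 0"
  using assms(1)
proof induction
  case (monom k c)
  then have "\<forall>j. k $ j \<in> \<int>" "k \<noteq> 0" using assms(2,3) by (auto simp: integer_vectors_def)
  then show ?case by (simp add: torus_orthogonality)
next
  case (add f g)
  then show ?case by (simp add: trig_poly_on_integrable)
qed simp

section \<open>Half-space projections on even powers\<close>

text \<open>The pointwise inequality behind M. Riesz's theorem. If \<open>h = - g\<close> then \<open>- g * cnj h\<close> is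
\<open>cmod g ^ 2\<close>, a positive real, so its \<open>m\<close>-th power recovers \<open>cmod g ^ (2 * m)\<close>. By continuity
the real part of that power still exceeds half of it when \<open>g + h\<close> is small compared to \<open>g\<close>; in
the remaining case \<open>g\<close> and \<open>h\<close> are both dominated by a multiple of \<open>g + h\<close>. All terms are
homogeneous of the same degree, which makes the constant uniform.\<close>

lemma even_power_le_real_part_plus_sum:
  assumes "0 < m"
  obtains A where "1 \<le> A" "\<And>g h :: complex. cmod g ^ (2 * m) \<le> 2 * Re ((- (g * cnj h)) ^ m) + A * cmod (g + h) ^ (2 * m)"
proof -
  have "isCont (\<lambda>u::complex. Re ((1 - u) ^ m)) 0"
    by (intro bounded_linear.isCont[OF bounded_linear_Re] continuous_intros)
  then obtain \<delta> where \<delta>: "\<delta> > 0" "\<And>u. cmod u < \<delta> \<Longrightarrow> 1 / 2 < Re ((1 - u) ^ m)"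
  proof -
    assume *: "\<And>\<delta>. 0 < \<delta> \<Longrightarrow> (\<And>u. cmod u < \<delta> \<Longrightarrow> 1 / 2 < Re ((1 - u) ^ m)) \<Longrightarrow> thesis"
    from \<open>isCont _ _\<close> have "((\<lambda>u::complex. Re ((1 - u) ^ m)) \<longlongrightarrow> Re ((1 - 0) ^ m)) (nhds 0)"
      unfolding isCont_def by (rule iffD1[OF tendsto_at_iff_tendsto_nhds])
    then have "\<forall>\<^sub>F u::complex in nhds 0. 1 / 2 < Re ((1 - u) ^ m)"
      by (rule order_tendstoD) simp_all
    then show thesis using * by (auto simp: eventually_nhds_metric)
  qed
  define K where "K = 1 / \<delta>"
  define A where "A = 1 + K ^ (2 * m) + 2 * (K * (K + 1)) ^ m"
  have K: "K > 0" using \<delta> by (simp add: K_def)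
  have "cmod g ^ (2 * m) \<le> 2 * Re ((- (g * cnj h)) ^ m) + A * cmod (g + h) ^ (2 * m)" for g h
  proof -
    define w where "w = g + h"
    show ?thesis
    proof (cases "cmod g \<le> K * cmod w")
      case True
      have h: "cmod h \<le> (K + 1) * cmod w"
        using True norm_triangle_ineq4[of w g] by (simp add: w_def algebra_simps)
      have "cmod ((- (g * cnj h)) ^ m) = (cmod g * cmod h) ^ m" by (simp add: norm_power norm_mult)
      also have "\<dots> \<le> ((K * cmod w) * ((K + 1) * cmod w)) ^ m"
        using True h K by (intro power_mono mult_mono) auto
      also have "\<dots> = (K * (K + 1)) ^ m * cmod w ^ (2 * m)"
        by (simp add: power_mult_distrib power_mult power2_eq_square)
      finally have 1: "- Re ((- (g * cnj h)) ^ m) \<le> (K * (K + 1)) ^ m * cmod w ^ (2 * m)"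
        using abs_Re_le_cmod[of "(- (g * cnj h)) ^ m"] by linarith
      have 2: "cmod g ^ (2 * m) \<le> K ^ (2 * m) * cmod w ^ (2 * m)"
        using power_mono[OF True, of "2 * m"] by (simp add: power_mult_distrib)
      have "0 \<le> cmod w ^ (2 * m)" by simp
      then show ?thesis
        using 1 2 unfolding A_def w_def[symmetric] distrib_right mult.assoc mult_1 by linarith
    next
      case False
      \<comment> \<open>With \<open>w = g + h\<close>, the quantity \<open>- g * cnj h\<close> equals \<open>cmod g ^ 2 * (1 - u)\<close>.\<close>
      define u where "u = cnj w / cnj g"
      have g: "g \<noteq> 0" using False K by auto
      have "cmod u < \<delta>"
        using False g \<delta>(1) by (simp add: u_def norm_divide K_def field_simps)
      then have "1 / 2 < Re ((1 - u) ^ m)" using \<delta> by blast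
      moreover have "- (g * cnj h) = of_real ((cmod g)\<^sup>2) * (1 - u)"
        unfolding complex_norm_square using g by (simp add: u_def w_def field_simps)
      then have "(- (g * cnj h)) ^ m = of_real (cmod g ^ (2 * m)) * (1 - u) ^ m"
        by (simp add: power_mult_distrib power_mult)
      then have "Re ((- (g * cnj h)) ^ m) = cmod g ^ (2 * m) * Re ((1 - u) ^ m)" by simp
      ultimately have "cmod g ^ (2 * m) \<le> 2 * Re ((- (g * cnj h)) ^ m)"
        using mult_left_mono[of "1/2" "Re ((1 - u) ^ m)" "cmod g ^ (2 * m)"] by simp
      moreover have "0 \<le> A * cmod w ^ (2 * m)" using K by (simp add: A_def)
      ultimately show ?thesis by (simp add: w_def)
    qed
  qed
  moreover have "1 \<le> A" using K by (simp add: A_def)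
  ultimately show thesis using that by blast
qed

text \<open>Open and closed half-spaces share the one property used below: some linear functional is strictly
larger at every point inside than at every point outside, so that differences of an inside and an
outside point lie in one open half-space bounded by a hyperplane through the origin.\<close>

definition halfspace_like :: "(real ^ 'n::finite) set \<Rightarrow> bool" where
  "halfspace_like H \<longleftrightarrow> (\<exists>a. \<forall>k\<in>H. \<forall>l\<in>-H. a \<bullet> l < a \<bullet> k)"

lemma integrable_trig_sum_power:
  "integrable torus_measure (\<lambda>x. cmod (trig_sum c K x) ^ m)"
  by (rule integrable_torus[where B = "(\<Sum>k\<in>K. cmod (c k)) ^ m"])
     (auto intro!: continuous_intros power_mono norm_trig_sum_le)

text \<open>Split a trigonometric polynomial into its parts \<open>g\<close> and \<open>h\<close> with frequencies inside and outside
\<open>H\<close>. Every frequency \<open>k - l\<close> of \<open>g * cnj h\<close> satisfies \<open>0 < a \<bullet> (k - l)\<close>, and so does every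
frequency of its powers. Hence \<open>(- (g * cnj h)) ^ m\<close> has no constant term and integrates to zero,
and integrating the pointwise inequality leaves only the norm of \<open>g + h\<close> on the right.\<close>

lemma halfspace_projection_bounded:
  assumes "0 < m"
  obtains A where "1 \<le> A"
    "\<And>(K :: (real ^ 'n::finite) set) H c. finite K \<Longrightarrow> K \<subseteq> integer_vectors \<Longrightarrow> halfspace_like H \<Longrightarrow>
       (\<integral>x. cmod (trig_sum c (K \<inter> H) x) ^ (2 * m) \<partial>torus_measure)
       \<le> A * (\<integral>x. cmod (trig_sum c K x) ^ (2 * m) \<partial>torus_measure)"
proof -
  obtain A where A: "1 \<le> A"
    "\<And>g h :: complex. cmod g ^ (2 * m) \<le> 2 * Re ((- (g * cnj h)) ^ m) + A * cmod (g + h) ^ (2 * m)"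
    using even_power_le_real_part_plus_sum[OF assms] by metis
  have "(\<integral>x. cmod (trig_sum c (K \<inter> H) x) ^ (2 * m) \<partial>torus_measure)
       \<le> A * (\<integral>x. cmod (trig_sum c K x) ^ (2 * m) \<partial>torus_measure)"
    if K: "finite K" "K \<subseteq> integer_vectors" and H: "halfspace_like H" for K H :: "(real ^ 'n) set" and c
  proof -
    obtain a where a: "\<And>k l. k \<in> H \<Longrightarrow> l \<notin> H \<Longrightarrow> a \<bullet> l < a \<bullet> k" using H by (auto simp: halfspace_like_def)
    define g h where "g = trig_sum c (K \<inter> H)" and "h = trig_sum c (K - H)"
    define X where "X = {k \<in> integer_vectors. 0 < a \<bullet> k}"
    have gh: "trig_sum c K x = g x + h x" for x
      unfolding g_def h_def trig_sum_def using K(1) by (rule sum.Int_Diff)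
    have "trig_poly_on (integer_vectors \<inter> H) g" "trig_poly_on (integer_vectors - H) h"
      unfolding g_def h_def using K by (auto intro!: trig_poly_on_trig_sum)
    then have "trig_poly_on X (\<lambda>x. g x * cnj (h x))"
      by (intro trig_poly_on_mult[OF _ trig_poly_on_cnj[where Y = "uminus ` (integer_vectors - H)"]])
         (auto simp: X_def a inner_diff_right intro: integer_vectors_diff)
    from trig_poly_on_mult[OF trig_poly_on.monom[of 0 "{0}" "-1"] this, of X]
    have "trig_poly_on X (\<lambda>x. - (g x * cnj (h x)))" by simp
    then have "trig_poly_on X (\<lambda>x. (- (g x * cnj (h x))) ^ Suc (m - 1))"
      by (rule trig_poly_on_power) (auto simp: X_def inner_add_right intro: integer_vectors_add)
    then have *: "trig_poly_on X (\<lambda>x. (- (g x * cnj (h x))) ^ m)" using assms by simp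
    have zero: "(\<integral>x. (- (g x * cnj (h x))) ^ m \<partial>torus_measure) = 0"
      by (rule trig_poly_on_integral_zero[OF *]) (auto simp: X_def)
    have int: "integrable torus_measure (\<lambda>x. (- (g x * cnj (h x))) ^ m)"
      by (rule trig_poly_on_integrable[OF *])
    have "(\<integral>x. cmod (g x) ^ (2 * m) \<partial>torus_measure)
        \<le> (\<integral>x. 2 * Re ((- (g x * cnj (h x))) ^ m) + A * cmod (g x + h x) ^ (2 * m) \<partial>torus_measure)"
    proof (rule integral_mono)
      show "integrable torus_measure (\<lambda>x. cmod (g x) ^ (2 * m))"
        unfolding g_def by (rule integrable_trig_sum_power)
      show "integrable torus_measure (\<lambda>x. 2 * Re ((- (g x * cnj (h x))) ^ m) + A * cmod (g x + h x) ^ (2 * m))"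
        using int integrable_trig_sum_power[of c K "2 * m"] unfolding gh
        by (intro Bochner_Integration.integrable_add integrable_mult_right integrable_Re)
    qed (rule A(2))
    also have "\<dots> = A * (\<integral>x. cmod (g x + h x) ^ (2 * m) \<partial>torus_measure)"
      using int integrable_trig_sum_power[of c K] zero by (simp add: gh[symmetric])
    finally show ?thesis by (simp add: g_def[symmetric] gh[symmetric])
  qed
  with A(1) that show thesis by blast
qed

section \<open>Coefficients, and evaluation at the origin\<close>

lemma lattice_points_eq: "lattice_points W = W \<inter> integer_vectors"
  by (auto simp: lattice_points_def integer_vectors_def)

lemma trig_sum_coefficient:
  fixes K :: "(real ^ 'n::finite) set"
  assumes "finite K" "K \<subseteq> integer_vectors" "l \<in> integer_vectors"
  shows "(\<integral>x. trig_sum c K x * cnj (cis (l \<bullet> x)) \<partial>torus_measure) = (if l \<in> K then c l else 0)"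
proof -
  have eq: "cis (k \<bullet> x) * cnj (cis (l \<bullet> x)) = cis ((k - l) \<bullet> x)" for k x
    by (simp add: cis_cnj cis_mult inner_diff_left)
  have int: "integrable torus_measure (\<lambda>x. cis (k \<bullet> x))" for k :: "real ^ 'n"
    by (rule integrable_torus[where B = 1]) (auto intro!: continuous_intros)
  have "(\<integral>x. trig_sum c K x * cnj (cis (l \<bullet> x)) \<partial>torus_measure)
      = (\<integral>x. (\<Sum>k\<in>K. c k * cis ((k - l) \<bullet> x)) \<partial>torus_measure)"
    by (simp add: trig_sum_def sum_distrib_right mult.assoc eq)
  also have "\<dots> = (\<Sum>k\<in>K. c k * (\<integral>x. cis ((k - l) \<bullet> x) \<partial>torus_measure))"
    by (subst Bochner_Integration.integral_sum) (auto intro!: int)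
  also have "\<dots> = (\<Sum>k\<in>K. if l = k then c k else 0)"
  proof (rule sum.cong[OF refl])
    fix k assume "k \<in> K"
    then have "k - l \<in> integer_vectors" using assms integer_vectors_diff by blast
    then have "(\<integral>x. cis ((k - l) \<bullet> x) \<partial>torus_measure) = (if k - l = 0 then 1 else 0)"
      by (intro torus_orthogonality) (auto simp: integer_vectors_def)
    then show "c k * (\<integral>x. cis ((k - l) \<bullet> x) \<partial>torus_measure) = (if l = k then c k else 0)" by simp
  qed
  also have "\<dots> = (if l \<in> K then c l else 0)"
    using assms(1) by (simp add: sum.delta)
  finally show ?thesis .
qed

lemma trig_sum_inner:
  fixes K L :: "(real ^ 'n::finite) set"
  assumes "finite K" "K \<subseteq> integer_vectors" "finite L" "L \<subseteq> integer_vectors"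
  shows "(\<integral>x. trig_sum c K x * cnj (trig_sum d L x) \<partial>torus_measure) = (\<Sum>k\<in>K \<inter> L. c k * cnj (d k))"
proof -
  have "integrable torus_measure (\<lambda>x. trig_sum c K x * cnj (cis (l \<bullet> x)))" for l :: "real ^ 'n"
    by (rule integrable_torus[where B = "(\<Sum>k\<in>K. cmod (c k)) * 1"])
       (auto intro!: continuous_intros norm_trig_sum_le simp: norm_mult)
  then have "(\<integral>x. trig_sum c K x * cnj (trig_sum d L x) \<partial>torus_measure)
      = (\<Sum>l\<in>L. cnj (d l) * (\<integral>x. trig_sum c K x * cnj (cis (l \<bullet> x)) \<partial>torus_measure))"
    unfolding trig_sum_def[of d]
    by (simp add: sum_distrib_left mult.left_commute Bochner_Integration.integral_sum)
  also have "\<dots> = (\<Sum>l\<in>L. if l \<in> K then c l * cnj (d l) else 0)"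
    by (rule sum.cong[OF refl], subst trig_sum_coefficient) (use assms in auto)
  also have "\<dots> = (\<Sum>k\<in>K \<inter> L. c k * cnj (d k))"
    using sum.inter_restrict[OF assms(3), of "\<lambda>k. c k * cnj (d k)" K] by (simp add: Int_commute)
  finally show ?thesis .
qed

lemma trig_sum_parseval:
  fixes K :: "(real ^ 'n::finite) set"
  assumes "finite K" "K \<subseteq> integer_vectors"
  shows "(\<integral>x. cmod (trig_sum c K x) ^ 2 \<partial>torus_measure) = (\<Sum>k\<in>K. cmod (c k) ^ 2)"
proof -
  have "complex_of_real (\<integral>x. cmod (trig_sum c K x) ^ 2 \<partial>torus_measure)
      = (\<integral>x. complex_of_real (cmod (trig_sum c K x) ^ 2) \<partial>torus_measure)"
    by (rule integral_complex_of_real[symmetric])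
  also have "\<dots> = (\<integral>x. trig_sum c K x * cnj (trig_sum c K x) \<partial>torus_measure)"
    by (simp only: complex_norm_square)
  also have "\<dots> = complex_of_real (\<Sum>k\<in>K. cmod (c k) ^ 2)"
    unfolding trig_sum_inner[OF assms assms] by (simp only: complex_norm_square of_real_sum Int_absorb)
  finally show ?thesis by (simp only: of_real_eq_iff)
qed

lemma lattice_points_box:
  fixes n :: "real ^ 'n::finite"
  assumes n: "\<And>j. 0 \<le> n $ j"
  shows "finite (lattice_points (cbox 0 n))" "real (card (lattice_points (cbox 0 n))) \<le> (\<Prod>j\<in>UNIV. (n $ j + 1))"
proof -
  let ?F = "\<lambda>k :: real ^ 'n. \<lambda>j. nat \<lfloor>k $ j\<rfloor>"
  let ?B = "Pi\<^sub>E (UNIV :: 'n set) (\<lambda>j. {..nat \<lfloor>n $ j\<rfloor>})"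
  have inj: "inj_on ?F (lattice_points (cbox 0 n))"
  proof (rule inj_onI)
    fix k l assume k: "k \<in> lattice_points (cbox 0 n)" and l: "l \<in> lattice_points (cbox 0 n)" and eq: "?F k = ?F l"
    have "real (nat \<lfloor>k $ j\<rfloor>) = k $ j" if "k \<in> lattice_points (cbox 0 n)" for k j
      using that by (auto simp: lattice_points_def mem_box_cart)
    then have "k $ j = l $ j" for j using k l fun_cong[OF eq, of j] by metis
    then show "k = l" by (simp add: vec_eq_iff)
  qed
  have sub: "?F ` lattice_points (cbox 0 n) \<subseteq> ?B"
    by (auto simp: lattice_points_def mem_box_cart PiE_def intro!: nat_mono floor_mono)
  have fin: "finite ?B" by (intro finite_PiE) auto
  show "finite (lattice_points (cbox 0 n))"
    using finite_imageD[OF finite_subset[OF sub fin] inj] .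
  have "card (lattice_points (cbox 0 n)) = card (?F ` lattice_points (cbox 0 n))"
    using inj by (simp add: card_image)
  also have "\<dots> \<le> card ?B" using sub fin by (rule card_mono[rotated])
  also have "\<dots> = (\<Prod>j\<in>UNIV. Suc (nat \<lfloor>n $ j\<rfloor>))" by (subst card_PiE) auto
  finally have "real (card (lattice_points (cbox 0 n))) \<le> (\<Prod>j\<in>UNIV. real (Suc (nat \<lfloor>n $ j\<rfloor>)))"
    by (metis of_nat_le_iff of_nat_prod)
  also have "\<dots> \<le> (\<Prod>j\<in>UNIV. (n $ j + 1))"
  proof (intro prod_mono conjI)
    fix j
    have "real (nat \<lfloor>n $ j\<rfloor>) \<le> n $ j" using n[of j] by simp
    then show "real (Suc (nat \<lfloor>n $ j\<rfloor>)) \<le> n $ j + 1" by simp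
  qed simp
  finally show "real (card (lattice_points (cbox 0 n))) \<le> (\<Prod>j\<in>UNIV. (n $ j + 1))" .
qed

text \<open>A Nikolskii inequality for the value at the origin, which is the sum of the coefficients. The
\<open>m\<close>-th power of the polynomial has its spectrum in the \<open>m\<close>-fold dilated box, so the case of exponent 2
(Cauchy-Schwarz and Parseval) applied to the power gives the bound; the factor in front of the
integral estimates the number of lattice points of the dilated box.\<close>

lemma nikolskii_even:
  fixes n :: "real ^ 'n::finite"
  assumes "0 < m" and n: "\<And>j. 0 \<le> n $ j" and K: "K \<subseteq> lattice_points (cbox 0 n)"
  shows "cmod (\<Sum>k\<in>K. c k) ^ (2 * m) \<le> real m ^ CARD('n) * (\<Prod>j\<in>UNIV. (n $ j + 1)) *
           (\<integral>x. cmod (trig_sum c K x) ^ (2 * m) \<partial>torus_measure)"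
proof -
  have finK: "finite K" using K lattice_points_box(1)[OF n] finite_subset by blast
  define X where "X r = lattice_points (cbox 0 (real r *\<^sub>R n))" for r
  have pow: "trig_poly_on (X (Suc r)) (\<lambda>x. trig_sum c K x ^ Suc r)" for r
  proof (induction r)
    case 0
    show ?case using trig_poly_on_trig_sum[OF finK K, of c] by (simp add: X_def)
  next
    case (Suc r)
    have "trig_poly_on (X (Suc (Suc r))) (\<lambda>x. trig_sum c K x * trig_sum c K x ^ Suc r)"
    proof (rule trig_poly_on_mult[OF trig_poly_on_trig_sum[OF finK K, of c] Suc])
      fix k l assume "k \<in> lattice_points (cbox 0 n)" "l \<in> X (Suc r)"
      then have kl: "0 \<le> k $ j" "k $ j \<le> n $ j" "0 \<le> l $ j" "l $ j \<le> real (Suc r) * n $ j"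
        "k $ j \<in> \<int>" "l $ j \<in> \<int>" for j
        by (simp_all add: X_def lattice_points_def mem_box_cart)
      have "k $ j + l $ j \<le> real (Suc (Suc r)) * n $ j" for j
        using kl(2,4)[of j] by (simp add: algebra_simps)
      then show "k + l \<in> X (Suc (Suc r))"
        using kl by (simp add: X_def lattice_points_def mem_box_cart add_nonneg_nonneg del: of_nat_Suc)
    qed
    then show ?case by simp
  qed
  have Xn: "0 \<le> (real m *\<^sub>R n) $ j" for j using n[of j] by simp
  have X: "finite (X m)" "real (card (X m)) \<le> (\<Prod>j\<in>UNIV. (real m * n $ j + 1))" "X m \<subseteq> integer_vectors"
    unfolding X_def using lattice_points_box[OF Xn] by (auto simp: lattice_points_eq)
  have "trig_poly_on (X m) (\<lambda>x. trig_sum c K x ^ m)" using pow[of "m - 1"] assms by simp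
  then obtain d where d: "(\<lambda>x. trig_sum c K x ^ m) = trig_sum d (X m)"
    using trig_poly_on_eq_trig_sum[OF _ X(1)] by metis
  have "cmod (\<Sum>k\<in>K. c k) ^ (2 * m) = cmod (trig_sum c K 0 ^ m) ^ 2"
    by (simp add: trig_sum_def power_mult norm_power power_even_eq mult.commute)
  also have "trig_sum c K 0 ^ m = trig_sum d (X m) 0" using fun_cong[OF d, of 0] by simp
  also have "cmod (trig_sum d (X m) 0) ^ 2 \<le> (\<Sum>k\<in>X m. 1 * cmod (d k)) ^ 2"
    unfolding trig_sum_def by (intro power_mono) (auto intro: norm_sum)
  also have "\<dots> \<le> (\<Sum>k\<in>X m. 1 ^ 2) * (\<Sum>k\<in>X m. cmod (d k) ^ 2)"
    by (rule Cauchy_Schwarz_ineq_sum)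
  also have "\<dots> = real (card (X m)) * (\<integral>x. cmod (trig_sum d (X m) x) ^ 2 \<partial>torus_measure)"
    using trig_sum_parseval[OF X(1,3)] by simp
  also have "(\<lambda>x. cmod (trig_sum d (X m) x) ^ 2) = (\<lambda>x. cmod (trig_sum c K x) ^ (2 * m))"
    by (simp add: d[symmetric] norm_power power_mult[symmetric] mult.commute)
  also have "real (card (X m)) * (\<integral>x. cmod (trig_sum c K x) ^ (2 * m) \<partial>torus_measure)
     \<le> (real m ^ CARD('n) * (\<Prod>j\<in>UNIV. (n $ j + 1))) * (\<integral>x. cmod (trig_sum c K x) ^ (2 * m) \<partial>torus_measure)"
  proof (rule mult_right_mono)
    have "(\<Prod>j\<in>(UNIV :: 'n set). (real m * n $ j + 1)) \<le> (\<Prod>j\<in>(UNIV :: 'n set). real m * (n $ j + 1))"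
      using n \<open>0 < m\<close> by (intro prod_mono) (auto simp: algebra_simps intro: add_nonneg_nonneg)
    then show "real (card (X m)) \<le> real m ^ CARD('n) * (\<Prod>j\<in>UNIV. (n $ j + 1))"
      using X(2) by (simp add: prod.distrib)
  qed simp
  finally show ?thesis by simp
qed

section \<open>Duality\<close>

lemma trig_poly_on_sum:
  "finite I \<Longrightarrow> (\<And>i. i \<in> I \<Longrightarrow> trig_poly_on X (f i)) \<Longrightarrow> trig_poly_on X (\<lambda>x. \<Sum>i\<in>I. f i x)"
  by (induction rule: finite_induct) (auto intro: trig_poly_on.intros)

lemma trig_poly_on_cmult: "trig_poly_on X f \<Longrightarrow> trig_poly_on X (\<lambda>x. c * f x)"
  by (rule trig_poly_on_mult[of "{0}" "\<lambda>x. c"]) (use trig_poly_on.monom[of 0 "{0}" c] in auto)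

definition torus_embedding :: "real ^ 'n::finite \<Rightarrow> complex ^ 'n" where
  "torus_embedding x = (\<chi> j. cis (x $ j))"

text \<open>On the torus the real and imaginary parts of the coordinates are \<open>cos (x $ j)\<close> and \<open>sin (x $ j)\<close>,
that is, combinations of the characters with frequencies \<open>axis j 1\<close> and \<open>- axis j 1\<close>.\<close>

lemma trig_poly_on_polynomial_torus_embedding:
  fixes r :: "complex ^ 'n::finite \<Rightarrow> real"
  assumes "real_polynomial_function r"
  shows "trig_poly_on integer_vectors (\<lambda>x :: real ^ 'n. complex_of_real (r (torus_embedding x)))"
  using assms
proof induction
  case (linear r)
  then interpret bounded_linear r .
  have *: "torus_embedding x = (\<Sum>j\<in>UNIV. cos (x $ j) *\<^sub>R axis j 1 + sin (x $ j) *\<^sub>R axis j \<i>)" for x :: "real ^ 'n"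
  proof (rule vec_eq_iff[THEN iffD2], rule allI)
    fix i
    have "(\<Sum>j\<in>UNIV. cos (x $ j) *\<^sub>R axis j 1 + sin (x $ j) *\<^sub>R axis j \<i>) $ i
        = (\<Sum>j\<in>UNIV. if i = j then cis (x $ j) else 0)"
      unfolding sum_component by (intro sum.cong refl) (auto simp: axis_def complex_eq_iff)
    then show "torus_embedding x $ i = (\<Sum>j\<in>UNIV. cos (x $ j) *\<^sub>R axis j 1 + sin (x $ j) *\<^sub>R axis j \<i>) $ i"
      by (simp add: torus_embedding_def)
  qed
  have "trig_poly_on integer_vectors (\<lambda>x. \<Sum>j\<in>UNIV.
      ((r (axis j 1) - \<i> * r (axis j \<i>)) / 2) * cis (axis j 1 \<bullet> x)
      + ((r (axis j 1) + \<i> * r (axis j \<i>)) / 2) * cis ((- axis j 1) \<bullet> x))"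
    by (intro trig_poly_on_sum trig_poly_on.intros) (auto simp: integer_vectors_def axis_def)
  moreover have "complex_of_real (r (torus_embedding x)) = (\<Sum>j\<in>UNIV.
      ((r (axis j 1) - \<i> * r (axis j \<i>)) / 2) * cis (axis j 1 \<bullet> x)
      + ((r (axis j 1) + \<i> * r (axis j \<i>)) / 2) * cis ((- axis j 1) \<bullet> x))" for x :: "real ^ 'n"
    unfolding * sum add scale of_real_sum
    by (intro sum.cong refl) (simp add: complex_eq_iff inner_axis' field_simps)
  ultimately show ?case by simp
next
  case (const c)
  have "0 \<in> (integer_vectors :: (real ^ 'n) set)" by (simp add: integer_vectors_def)
  from trig_poly_on.monom[OF this, of c] show ?case by simp
next
  case (add f g)
  then show ?case by (simp add: trig_poly_on.add)
next
  case (mult f g)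
  then show ?case using trig_poly_on_mult[OF mult.IH integer_vectors_add] by simp
qed

lemma compact_polytorus: "compact {z :: complex ^ 'n::finite. \<forall>j. cmod (z $ j) = 1}"
proof (rule compact_eq_bounded_closed[THEN iffD2], intro conjI)
  show "bounded {z :: complex ^ 'n. \<forall>j. cmod (z $ j) = 1}"
  proof (rule boundedI)
    fix z :: "complex ^ 'n" assume "z \<in> {z. \<forall>j. cmod (z $ j) = 1}"
    then show "norm z \<le> L2_set (\<lambda>_. 1) (UNIV :: 'n set)" by (simp add: norm_vec_def)
  qed
  have "{z :: complex ^ 'n. \<forall>j. cmod (z $ j) = 1} = (\<Inter>j. {z. cmod (z $ j) = 1})" by auto
  then show "closed {z :: complex ^ 'n. \<forall>j. cmod (z $ j) = 1}"
    by (auto intro!: closed_INT closed_Collect_eq continuous_intros)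
qed

text \<open>Frequencies in the box are nonnegative integers, so \<open>trig_sum c K\<close> is a polynomial in the
coordinates \<open>cis (x $ j)\<close>. Thus \<open>\<phi> \<circ> trig_sum c K\<close> factors through a continuous function on the
compact polytorus, where Stone-Weierstrass provides polynomial approximations.\<close>

lemma trig_poly_approximation:
  fixes n :: "real ^ 'n::finite" and \<phi> :: "complex \<Rightarrow> complex"
  assumes \<phi>: "continuous_on UNIV \<phi>" and K: "K \<subseteq> lattice_points (cbox 0 n)" and "0 < e"
  obtains f where "trig_poly_on integer_vectors f" "\<And>x. cmod (\<phi> (trig_sum c K x) - f x) < e"
proof -
  define S where "S = {z :: complex ^ 'n. \<forall>j. cmod (z $ j) = 1}"
  define F where "F z = \<phi> (\<Sum>k\<in>K. c k * (\<Prod>j\<in>UNIV. (z $ j) ^ nat \<lfloor>k $ j\<rfloor>))" for z :: "complex ^ 'n"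
  have "continuous_on S F"
    unfolding F_def by (rule continuous_on_compose2[OF \<phi>]) (auto intro!: continuous_intros)
  then obtain g where g: "polynomial_function g" "\<And>z. z \<in> S \<Longrightarrow> cmod (F z - g z) < e"
    using Stone_Weierstrass_polynomial_function[OF _ _ \<open>0 < e\<close>, of S F] compact_polytorus
    unfolding S_def by blast
  have "real_polynomial_function (Re \<circ> g)" "real_polynomial_function (Im \<circ> g)"
    using g(1) bounded_linear_Re bounded_linear_Im by (auto simp: polynomial_function_def)
  then have "trig_poly_on integer_vectors (\<lambda>x :: real ^ 'n. complex_of_real ((Re \<circ> g) (torus_embedding x))
      + \<i> * complex_of_real ((Im \<circ> g) (torus_embedding x)))"
    by (intro trig_poly_on.add trig_poly_on_cmult trig_poly_on_polynomial_torus_embedding)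
  then have "trig_poly_on integer_vectors (\<lambda>x :: real ^ 'n. g (torus_embedding x))"
    by (simp add: complex_eq[symmetric])
  moreover have "cmod (\<phi> (trig_sum c K x) - g (torus_embedding x)) < e" for x
  proof -
    have "cis (k \<bullet> x) = (\<Prod>j\<in>UNIV. (torus_embedding x $ j) ^ nat \<lfloor>k $ j\<rfloor>)" if "k \<in> K" for k
    proof -
      have "real (nat \<lfloor>k $ j\<rfloor>) = k $ j" for j
        using that K by (auto simp: lattice_points_def mem_box_cart)
      then have "cis (x $ j) ^ nat \<lfloor>k $ j\<rfloor> = cis (k $ j * x $ j)" for j
        by (metis Complex.DeMoivre)
      then show ?thesis
        by (simp only: inner_vec_def inner_real_def cis_sum[OF finite] torus_embedding_def vec_lambda_beta)
    qed
    then have "\<phi> (trig_sum c K x) = F (torus_embedding x)"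
      by (simp add: F_def trig_sum_def)
    moreover have "torus_embedding x \<in> S" by (simp add: S_def torus_embedding_def)
    ultimately show ?thesis using g(2) by simp
  qed
  ultimately show thesis using that by blast
qed

lemma norm_signed_powr: "cmod (z * of_real (cmod z powr (r - 1))) = cmod z powr r"
  using powr_mult_base[of "cmod z" "r - 1"] by (simp add: norm_mult)

text \<open>For \<open>r = q - 1\<close> this map turns a function with integrable \<open>q\<close>-th power into the function that attains
its norm in the duality with the conjugate exponent. It keeps the argument and raises the modulus to the power \<open>r\<close>, which is why it is continuous also at the origin,
where the second factor blows up for \<open>r < 1\<close>.\<close>

lemma continuous_on_signed_powr:
  assumes "0 < r"
  shows "continuous_on UNIV (\<lambda>z :: complex. z * of_real (cmod z powr (r - 1)))"
proof -
  have "isCont (\<lambda>z :: complex. z * of_real (cmod z powr (r - 1))) z" for z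
  proof (cases "z = 0")
    case True
    have "((\<lambda>z :: complex. cmod z powr r) \<longlongrightarrow> 0 powr r) (at 0)"
      by (rule tendsto_powr'[OF tendsto_norm_zero[OF tendsto_ident_at] tendsto_const]) (simp add: assms)
    then have "((\<lambda>z :: complex. z * of_real (cmod z powr (r - 1))) \<longlongrightarrow> 0) (at 0)"
      by - (rule tendsto_norm_zero_cancel, simp only: norm_signed_powr powr_0)
    then show ?thesis using True by (simp add: isCont_def)
  next
    case False
    then show ?thesis by (intro continuous_intros) simp_all
  qed
  then show ?thesis by (simp add: continuous_on_eq_continuous_at)
qed

text \<open>Passage from the even exponent \<open>2 * m\<close> to the conjugate exponent \<open>q = 2 * m / (2 * m - 1)\<close>. For
\<open>D\<close> with all coefficients equal to one on \<open>K\<close>, the pairing of \<open>D\<close> with a trigonometric polynomial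
\<open>f\<close> is the conjugate of the sum of the coefficients of \<open>f\<close> over \<open>K\<close>, which the hypothesis controls by
the norm of \<open>f\<close>. Letting \<open>f\<close> tend uniformly to \<open>D * cmod D powr (q - 2)\<close> turns the pairing and the
\<open>2 * m\<close>-th power integral of \<open>f\<close> into the same integral \<open>I\<close> of \<open>cmod D powr q\<close>. The result
\<open>I ^ (2 * m) \<le> G * I\<close> is then divided by \<open>I\<close>.\<close>

lemma dual_norm_bound:
  fixes n :: "real ^ 'n::finite"
  assumes m: "0 < m" and n: "\<And>j. 0 \<le> n $ j" and K: "K \<subseteq> lattice_points (cbox 0 n)"
    and G: "\<And>L c. finite L \<Longrightarrow> L \<subseteq> integer_vectors \<Longrightarrow>
      cmod (\<Sum>k\<in>K \<inter> L. c k) ^ (2 * m) \<le> G * (\<integral>x. cmod (trig_sum c L x) ^ (2 * m) \<partial>torus_measure)"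
    and "0 \<le> G"
  shows "(\<integral>x. cmod (trig_sum (\<lambda>_. 1) K x) powr (real (2 * m) / real (2 * m - 1)) \<partial>torus_measure) ^ (2 * m - 1) \<le> G"
proof -
  \<comment> \<open>The conjugate exponent is \<open>1 + r\<close>.\<close>
  define r where "r = 1 / real (2 * m - 1)"
  define D where "D = trig_sum (\<lambda>_. 1) K"
  define \<phi> where "\<phi> z = z * complex_of_real (cmod z powr (r - 1))" for z
  define I where "I = (\<integral>x. cmod (D x) powr (1 + r) \<partial>torus_measure)"
  have r: "0 < r" "r * real (2 * m) = 1 + r"
    using m by (auto simp: r_def field_simps of_nat_diff)
  have K': "finite K" "K \<subseteq> integer_vectors"
    using finite_subset[OF K lattice_points_box(1)[OF n]] K by (auto simp: lattice_points_eq)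
  have \<phi>: "continuous_on UNIV \<phi>" unfolding \<phi>_def using continuous_on_signed_powr[OF r(1)] .
  have D: "continuous_on UNIV D" "cmod (D x) \<le> real (card K)" for x
    using norm_trig_sum_le[of "\<lambda>_. 1" K x] by (auto simp: D_def intro!: continuous_intros)
  have \<phi>_norm: "cmod (\<phi> z) = cmod z powr r" for z
    unfolding \<phi>_def by (rule norm_signed_powr)
  have "\<exists>f. trig_poly_on integer_vectors f \<and> (\<forall>x. cmod (\<phi> (D x) - f x) < inverse (Suc i))" for i
  proof -
    have "0 < inverse (real (Suc i))" by simp
    from trig_poly_approximation[OF \<phi> K this, of "\<lambda>_. 1"] show ?thesis unfolding D_def by metis
  qed
  then obtain f where f: "\<And>i. trig_poly_on integer_vectors (f i)"
      "\<And>i x. cmod (\<phi> (D x) - f i x) < inverse (Suc i)"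
    by metis
  define B where "B = real (card K) powr r + 1"
  have f_lim: "(\<lambda>i. f i x) \<longlonglongrightarrow> \<phi> (D x)" for x
  proof -
    have "(\<lambda>i. \<phi> (D x) - f i x) \<longlonglongrightarrow> 0"
      by (rule Lim_null_comparison[OF _ LIMSEQ_inverse_real_of_nat])
         (use f(2) in \<open>auto intro!: always_eventually less_imp_le\<close>)
    from tendsto_diff[OF tendsto_const[of "\<phi> (D x)"] this] show ?thesis by simp
  qed
  have f_bound: "cmod (f i x) \<le> B" for i x
  proof -
    have "cmod (f i x) \<le> cmod (\<phi> (D x)) + inverse (Suc i)"
      using f(2)[of x i] norm_triangle_ineq3[of "f i x" "\<phi> (D x)"] by (simp add: norm_minus_commute)
    also have "cmod (\<phi> (D x)) \<le> real (card K) powr r"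
      unfolding \<phi>_norm using D(2) r by (intro powr_mono2) auto
    also have "inverse (real (Suc i)) \<le> 1" by (simp add: field_simps)
    finally show ?thesis by (simp add: B_def)
  qed
  have const: "integrable torus_measure (\<lambda>_ :: real ^ 'n. b :: real)" for b
    by (rule integrable_torus) auto
  note f_cont = trig_poly_on_continuous_bounded(1)[OF f(1)]
  have meas: "g \<in> borel_measurable torus_measure" if "continuous_on UNIV g" for g :: "real ^ 'n \<Rightarrow> 'b::topological_space"
    using borel_measurable_continuous_onI[OF that] by (simp add: measurable_cong_sets[OF sets_torus_measure refl])
  have \<phi>D: "continuous_on UNIV (\<lambda>x. \<phi> (D x))"
    by (rule continuous_on_compose2[OF \<phi> D(1)]) auto
  have "(\<lambda>i. \<integral>x. D x * cnj (f i x) \<partial>torus_measure) \<longlonglongrightarrow> (\<integral>x. D x * cnj (\<phi> (D x)) \<partial>torus_measure)"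
  proof (rule integral_dominated_convergence[where w = "\<lambda>_. real (card K) * B"])
    show "AE x in torus_measure. (\<lambda>i. D x * cnj (f i x)) \<longlonglongrightarrow> D x * cnj (\<phi> (D x))"
      using f_lim by (intro AE_I2 tendsto_intros)
    show "AE x in torus_measure. cmod (D x * cnj (f i x)) \<le> real (card K) * B" for i
      using D(2) f_bound by (intro AE_I2) (auto simp: norm_mult intro!: mult_mono)
  qed (intro const meas continuous_intros D \<phi>D f_cont)+
  moreover have "D x * cnj (\<phi> (D x)) = complex_of_real (cmod (D x) powr (1 + r))" for x
  proof -
    have "D x * cnj (\<phi> (D x)) = complex_of_real (cmod (D x) ^ 2 * cmod (D x) powr (r - 1))"
      by (simp only: \<phi>_def of_real_mult complex_norm_square complex_cnj_mult complex_cnj_complex_of_real mult.assoc)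
    also have "cmod (D x) ^ 2 * cmod (D x) powr (r - 1) = cmod (D x) powr (1 + r)"
      using powr_mult_base[of "cmod (D x)" "r - 1"] powr_mult_base[of "cmod (D x)" r]
      by (simp add: power2_eq_square mult.assoc)
    finally show ?thesis .
  qed
  ultimately have lim1: "(\<lambda>i. cmod (\<integral>x. D x * cnj (f i x) \<partial>torus_measure) ^ (2 * m)) \<longlonglongrightarrow> cmod (complex_of_real I) ^ (2 * m)"
    unfolding I_def by (intro tendsto_intros) simp
  have "(\<lambda>i. \<integral>x. cmod (f i x) ^ (2 * m) \<partial>torus_measure) \<longlonglongrightarrow> (\<integral>x. cmod (\<phi> (D x)) ^ (2 * m) \<partial>torus_measure)"
  proof (rule integral_dominated_convergence[where w = "\<lambda>_. B ^ (2 * m)"])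
    show "AE x in torus_measure. (\<lambda>i. cmod (f i x) ^ (2 * m)) \<longlonglongrightarrow> cmod (\<phi> (D x)) ^ (2 * m)"
      using f_lim by (intro AE_I2 tendsto_intros)
    show "AE x in torus_measure. norm (cmod (f i x) ^ (2 * m)) \<le> B ^ (2 * m)" for i
      using f_bound by (intro AE_I2) (auto intro!: power_mono)
  qed (intro const meas continuous_intros D \<phi>D f_cont)+
  moreover have "cmod (\<phi> (D x)) ^ (2 * m) = cmod (D x) powr (1 + r)" for x
  proof -
    have "cmod (\<phi> (D x)) ^ (2 * m) = (cmod (D x) powr r) powr real (2 * m)"
      unfolding \<phi>_norm by (rule powr_realpow'[symmetric]) (use m in auto)
    then show ?thesis by (simp only: powr_powr r(2))
  qed
  ultimately have lim2: "(\<lambda>i. G * (\<integral>x. cmod (f i x) ^ (2 * m) \<partial>torus_measure)) \<longlonglongrightarrow> G * I"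
    unfolding I_def by (intro tendsto_intros) simp
  have "cmod (\<integral>x. D x * cnj (f i x) \<partial>torus_measure) ^ (2 * m) \<le> G * (\<integral>x. cmod (f i x) ^ (2 * m) \<partial>torus_measure)" for i
  proof -
    obtain L where L: "finite L" "L \<subseteq> integer_vectors" "trig_poly_on L (f i)"
      using trig_poly_on_finite[OF f(1)] .
    then obtain c where c: "f i = trig_sum c L" using trig_poly_on_eq_trig_sum by blast
    have "(\<integral>x. D x * cnj (f i x) \<partial>torus_measure) = cnj (\<Sum>k\<in>K \<inter> L. c k)"
      unfolding D_def c using trig_sum_inner[OF K' L(1,2)] by simp
    then show ?thesis using G[OF L(1,2), of c] by (simp only: complex_mod_cnj c)
  qed
  from LIMSEQ_le[OF lim1 lim2] this have le: "cmod (complex_of_real I) ^ (2 * m) \<le> G * I" by blast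
  have "0 \<le> I" unfolding I_def by simp
  have "I ^ (2 * m - 1) \<le> G"
  proof (cases "I = 0")
    case True
    then show ?thesis using m \<open>0 \<le> G\<close> by (simp add: power_0_left)
  next
    case False
    have "I ^ (2 * m) = I ^ (2 * m - 1) * I" using m power_Suc2[of I "2 * m - 1"] by simp
    then show ?thesis using le False \<open>0 \<le> I\<close> by simp
  qed
  moreover have "real (2 * m) / real (2 * m - 1) = 1 + r"
    using m by (simp add: r_def field_simps of_nat_diff)
  ultimately show ?thesis by (simp only: I_def D_def)
qed

section \<open>Cutting a triangulation into cells\<close>

text \<open>With \<open>V\<close> the vertices of a full-dimensional simplex and \<open>a v \<bullet> x + b v\<close> the barycentric coordinates
of \<open>x\<close>, this is the relative interior of the face with vertex set \<open>\<sigma>\<close>.\<close>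

definition open_cell :: "(real ^ 'n::finite) set \<Rightarrow> (real ^ 'n \<Rightarrow> real ^ 'n) \<Rightarrow> (real ^ 'n \<Rightarrow> real) \<Rightarrow> (real ^ 'n) set \<Rightarrow> (real ^ 'n) set" where
  "open_cell V a b \<sigma> = {x. \<forall>v\<in>V. if v \<in> \<sigma> then 0 < a v \<bullet> x + b v else a v \<bullet> x + b v = 0}"

lemma halfspace_like_gt: "halfspace_like {x. 0 < a \<bullet> x + b}"
  and halfspace_like_ge: "halfspace_like {x. 0 \<le> a \<bullet> x + b}"
  and halfspace_like_le: "halfspace_like {x. a \<bullet> x + b \<le> 0}"
  unfolding halfspace_like_def
  by (rule exI[of _ a], force) (rule exI[of _ a], force, rule exI[of _ "- a"], force)

text \<open>Each condition of a cell is one open half-space or, for a hyperplane, two opposite closed ones;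
hence at most two projections for every element of \<open>V\<close>.\<close>

lemma cell_projection_bounded:
  fixes V K :: "(real ^ 'n::finite) set"
  assumes A: "1 \<le> A"
    "\<And>(K :: (real ^ 'n) set) H c. finite K \<Longrightarrow> K \<subseteq> integer_vectors \<Longrightarrow> halfspace_like H \<Longrightarrow>
       (\<integral>x. cmod (trig_sum c (K \<inter> H) x) ^ (2 * m) \<partial>torus_measure)
       \<le> A * (\<integral>x. cmod (trig_sum c K x) ^ (2 * m) \<partial>torus_measure)"
    and V: "finite V" and K: "finite K" "K \<subseteq> integer_vectors"
  shows "(\<integral>x. cmod (trig_sum c (K \<inter> open_cell V a b \<sigma>) x) ^ (2 * m) \<partial>torus_measure)
       \<le> (A ^ 2) ^ card V * (\<integral>x. cmod (trig_sum c K x) ^ (2 * m) \<partial>torus_measure)"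
  using V
proof (induction V rule: finite_induct)
  case empty
  show ?case by (simp add: open_cell_def)
next
  case (insert v V)
  let ?I = "\<lambda>L. \<integral>x. cmod (trig_sum c L x) ^ (2 * m) \<partial>torus_measure"
  define L where "L = K \<inter> open_cell V a b \<sigma>"
  have L: "finite L" "L \<subseteq> integer_vectors" using K by (auto simp: L_def)
  have nonneg: "0 \<le> ?I M" for M :: "(real ^ 'n) set" by simp
  have "?I (K \<inter> open_cell (insert v V) a b \<sigma>) \<le> A ^ 2 * ?I L"
  proof (cases "v \<in> \<sigma>")
    case True
    then have eq: "K \<inter> open_cell (insert v V) a b \<sigma> = L \<inter> {x. 0 < a v \<bullet> x + b v}"
      by (auto simp: open_cell_def L_def)
    have "?I (L \<inter> {x. 0 < a v \<bullet> x + b v}) \<le> A * ?I L"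
      by (rule A(2)[OF L halfspace_like_gt])
    also have "\<dots> \<le> A ^ 2 * ?I L"
      using A(1) by (intro mult_right_mono nonneg) (simp add: power2_eq_square)
    finally show ?thesis unfolding eq .
  next
    case False
    then have eq: "K \<inter> open_cell (insert v V) a b \<sigma>
        = (L \<inter> {x. 0 \<le> a v \<bullet> x + b v}) \<inter> {x. a v \<bullet> x + b v \<le> 0}"
      by (auto simp: open_cell_def L_def)
    have "?I ((L \<inter> {x. 0 \<le> a v \<bullet> x + b v}) \<inter> {x. a v \<bullet> x + b v \<le> 0}) \<le> A * ?I (L \<inter> {x. 0 \<le> a v \<bullet> x + b v})"
      by (rule A(2)[OF _ _ halfspace_like_le]) (use L in auto)
    also have "\<dots> \<le> A * (A * ?I L)"
      using A(1) by (intro mult_left_mono A(2)[OF L halfspace_like_ge]) simp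
    finally show ?thesis unfolding eq by (simp add: power2_eq_square)
  qed
  also have "\<dots> \<le> A ^ 2 * ((A ^ 2) ^ card V * ?I K)"
    unfolding L_def using insert.IH by (rule mult_left_mono) simp
  finally show ?case using insert by simp
qed

text \<open>Completing \<open>C\<close> to an affine basis makes the barycentric coordinates affine functions on the whole
space. The equations of the affine hull of a lower-dimensional simplex then appear as the vanishing
of the coordinates at the added vertices, so simplices of all dimensions are treated alike.\<close>

lemma barycentric_functionals:
  fixes C :: "(real ^ 'n::finite) set"
  assumes "\<not> affine_dependent C"
  obtains V a b where "finite V" "card V = CARD('n) + 1" "C \<subseteq> V"
    "\<And>\<tau> x. \<tau> \<subseteq> V \<Longrightarrow> x \<in> convex hull \<tau> \<longleftrightarrow> (\<forall>v\<in>V. 0 \<le> a v \<bullet> x + b v) \<and> (\<forall>v\<in>V - \<tau>. a v \<bullet> x + b v = 0)"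
proof -
  obtain V where V: "\<not> affine_dependent V" "C \<subseteq> V" "affine hull V = UNIV"
    using extend_to_affine_basis[OF assms subset_UNIV] by auto
  have fin: "finite V" using V(1) aff_independent_finite by blast
  have card: "card V = CARD('n) + 1"
    using aff_dim_unique[of V UNIV] V by (simp add: hull_UNIV aff_dim_UNIV)
  have "\<exists>a b. (\<forall>w\<in>V. a \<bullet> w + b = (if w = v then 1 else (0 :: real)))" if "v \<in> V" for v
  proof -
    have "independent ((\<lambda>x. - v + x) ` (V - {v}))"
      using V(1) affine_dependent_iff_dependent2[OF that] by blast
    \<comment> \<open>The coordinate at \<open>v\<close> is \<open>1 + g (x - v)\<close>: it is 1 at \<open>v\<close> and drops by 1 at each other vertex.\<close>
    then obtain g :: "real ^ 'n \<Rightarrow> real" where g: "linear g" "\<forall>x\<in>(\<lambda>x. - v + x) ` (V - {v}). g x = -1"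
      using linear_independent_extend[of _ "\<lambda>_. -1 :: real"] by blast
    define a where "a = adjoint g 1"
    have a: "a \<bullet> x = g x" for x
      using adjoint_works[OF g(1), of x 1] by (simp add: a_def inner_commute)
    have "a \<bullet> w + (1 - a \<bullet> v) = (if w = v then 1 else 0)" if "w \<in> V" for w
    proof (cases "w = v")
      case False
      then have "g (- v + w) = -1" using g(2) that by blast
      then have "a \<bullet> (- v + w) = -1" by (simp add: a)
      then show ?thesis using False by (simp add: inner_diff_right)
    qed simp
    then show ?thesis by blast
  qed
  then obtain a b where ab: "\<And>v w. v \<in> V \<Longrightarrow> w \<in> V \<Longrightarrow> a v \<bullet> w + b v = (if w = v then 1 else (0 :: real))"
    by metis
  have coord: "a v \<bullet> (\<Sum>w\<in>V. u w *\<^sub>R w) + b v = u v" if "v \<in> V" "sum u V = 1" for u v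
  proof -
    have "a v \<bullet> (\<Sum>w\<in>V. u w *\<^sub>R w) + b v = (\<Sum>w\<in>V. u w * (a v \<bullet> w + b v))"
      using that(2) by (simp add: inner_sum_right distrib_left sum.distrib flip: sum_distrib_right)
    also have "\<dots> = (\<Sum>w\<in>V. if w = v then u w else 0)"
      using ab[OF that(1)] by (intro sum.cong) auto
    also have "\<dots> = u v" using fin that(1) by simp
    finally show ?thesis .
  qed
  have bary: "(\<Sum>v\<in>V. a v \<bullet> x + b v) = 1 \<and> (\<Sum>v\<in>V. (a v \<bullet> x + b v) *\<^sub>R v) = x" for x
  proof -
    have "x \<in> affine hull V" using V(3) by simp
    then obtain u where u: "sum u V = 1" "(\<Sum>v\<in>V. u v *\<^sub>R v) = x"
      by (auto simp: affine_hull_finite[OF fin])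
    have "a v \<bullet> x + b v = u v" if "v \<in> V" for v using coord[OF that u(1)] u(2) by simp
    then show ?thesis using u by simp
  qed
  have "x \<in> convex hull \<tau> \<longleftrightarrow> (\<forall>v\<in>V. 0 \<le> a v \<bullet> x + b v) \<and> (\<forall>v\<in>V - \<tau>. a v \<bullet> x + b v = 0)"
    if \<tau>: "\<tau> \<subseteq> V" for \<tau> x
  proof
    assume "x \<in> convex hull \<tau>"
    then obtain u where u: "\<forall>x\<in>\<tau>. 0 \<le> u x" "sum u \<tau> = 1" "(\<Sum>x\<in>\<tau>. u x *\<^sub>R x) = x"
      using convex_hull_finite[OF finite_subset[OF \<tau> fin]] by auto
    define u' where "u' v = (if v \<in> \<tau> then u v else 0)" for v
    have "sum u' V = 1"
      using sum.mono_neutral_right[of V \<tau> u'] u(2) \<tau> fin by (simp add: u'_def)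
    moreover have "(\<Sum>v\<in>V. u' v *\<^sub>R v) = x"
      using sum.mono_neutral_right[of V \<tau> "\<lambda>v. u' v *\<^sub>R v"] u(3) \<tau> fin by (simp add: u'_def)
    ultimately have "a v \<bullet> x + b v = u' v" if "v \<in> V" for v using coord[OF that] by blast
    then show "(\<forall>v\<in>V. 0 \<le> a v \<bullet> x + b v) \<and> (\<forall>v\<in>V - \<tau>. a v \<bullet> x + b v = 0)"
      using u(1) by (auto simp: u'_def)
  next
    assume x: "(\<forall>v\<in>V. 0 \<le> a v \<bullet> x + b v) \<and> (\<forall>v\<in>V - \<tau>. a v \<bullet> x + b v = 0)"
    have "(\<Sum>v\<in>\<tau>. a v \<bullet> x + b v) = (\<Sum>v\<in>V. a v \<bullet> x + b v)"
      by (rule sum.mono_neutral_left) (use x \<tau> fin in auto)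
    moreover have "(\<Sum>v\<in>\<tau>. (a v \<bullet> x + b v) *\<^sub>R v) = (\<Sum>v\<in>V. (a v \<bullet> x + b v) *\<^sub>R v)"
      by (rule sum.mono_neutral_left) (use x \<tau> fin in auto)
    ultimately show "x \<in> convex hull \<tau>"
      using x \<tau> bary[of x] unfolding convex_hull_finite[OF finite_subset[OF \<tau> fin]]
      by (auto intro!: exI[of _ "\<lambda>v. a v \<bullet> x + b v"])
  qed
  with that fin card V(2) show thesis by blast
qed

text \<open>Let \<open>\<sigma>\<close> be the set of vertices at which a point of the simplex has a positive coordinate. The point
lies in the face with vertex set \<open>\<tau>\<close> iff \<open>\<sigma> \<subseteq> \<tau>\<close>, so whether it belongs to the removed
faces depends on \<open>\<sigma>\<close> only. What remains is a disjoint union of cells, one for each admissible \<open>\<sigma>\<close>.\<close>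

lemma simplex_minus_faces_cells:
  fixes C :: "(real ^ 'n::finite) set"
  assumes "\<not> affine_dependent C" "\<And>S. S \<in> \<F> \<Longrightarrow> (convex hull C \<inter> S) face_of convex hull C"
  obtains V a b \<Sigma> where "finite V" "card V = CARD('n) + 1" "\<Sigma> \<subseteq> Pow V"
    "convex hull C - \<Union>\<F> = (\<Union>\<sigma>\<in>\<Sigma>. open_cell V a b \<sigma>)" "disjoint_family_on (open_cell V a b) \<Sigma>"
proof -
  obtain V a b where V: "finite V" "card V = CARD('n) + 1" "C \<subseteq> V" and
    hull: "\<And>\<tau> x. \<tau> \<subseteq> V \<Longrightarrow> x \<in> convex hull \<tau> \<longleftrightarrow> (\<forall>v\<in>V. 0 \<le> a v \<bullet> x + b v) \<and> (\<forall>v\<in>V - \<tau>. a v \<bullet> x + b v = 0)"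
    using barycentric_functionals[OF assms(1)] by metis
  have "\<exists>\<tau>\<subseteq>C. convex hull C \<inter> S = convex hull \<tau>" if "S \<in> \<F>" for S
    using assms(2)[OF that] face_of_convex_hull_affine_independent[OF assms(1)] by metis
  then obtain t where t: "\<And>S. S \<in> \<F> \<Longrightarrow> t S \<subseteq> C" "\<And>S. S \<in> \<F> \<Longrightarrow> convex hull C \<inter> S = convex hull (t S)"
    by metis
  \<comment> \<open>The set \<open>t S\<close> holds the vertices of the face that \<open>S\<close> cuts out; cells inside it are discarded.\<close>
  define \<Sigma> where "\<Sigma> = {\<sigma> \<in> Pow C. \<forall>S\<in>\<F>. \<not> \<sigma> \<subseteq> t S}"
  have cell: "0 \<le> a v \<bullet> x + b v" "a v \<bullet> x + b v = 0 \<longleftrightarrow> v \<notin> \<sigma>"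
    if "x \<in> open_cell V a b \<sigma>" "v \<in> V" for x \<sigma> v
    using that by (cases "v \<in> \<sigma>"; force simp: open_cell_def)+
  have cell_hull: "x \<in> convex hull \<tau> \<longleftrightarrow> \<sigma> \<subseteq> \<tau>" if x: "x \<in> open_cell V a b \<sigma>" and "\<sigma> \<subseteq> V" "\<tau> \<subseteq> V" for x \<sigma> \<tau>
    unfolding hull[OF that(3)] using cell[OF x] that(2) by blast
  have disj: "\<sigma> = \<rho>" if x: "x \<in> open_cell V a b \<sigma>" "x \<in> open_cell V a b \<rho>" and "\<sigma> \<subseteq> V" "\<rho> \<subseteq> V" for x \<sigma> \<rho>
    using cell(2)[OF x(1)] cell(2)[OF x(2)] that(3,4) by blast
  have "x \<in> convex hull C - \<Union>\<F> \<longleftrightarrow> x \<in> (\<Union>\<sigma>\<in>\<Sigma>. open_cell V a b \<sigma>)" for x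
  proof
    assume x: "x \<in> convex hull C - \<Union>\<F>"
    define \<sigma> where "\<sigma> = {v \<in> V. 0 < a v \<bullet> x + b v}"
    have in_cell: "x \<in> open_cell V a b \<sigma>"
      using x hull[OF V(3)] by (auto simp: open_cell_def \<sigma>_def order_le_less)
    have "\<sigma> \<subseteq> C" using cell_hull[OF in_cell _ V(3)] x by (auto simp: \<sigma>_def)
    moreover have "\<not> \<sigma> \<subseteq> t S" if "S \<in> \<F>" for S
    proof -
      have "x \<notin> convex hull t S" using t(2)[OF that] x that by blast
      then show ?thesis
        using cell_hull[OF in_cell, of "t S"] t(1)[OF that] V(3) by (auto simp: \<sigma>_def)
    qed
    ultimately show "x \<in> (\<Union>\<sigma>\<in>\<Sigma>. open_cell V a b \<sigma>)" using in_cell by (auto simp: \<Sigma>_def)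
  next
    assume "x \<in> (\<Union>\<sigma>\<in>\<Sigma>. open_cell V a b \<sigma>)"
    then obtain \<sigma> where \<sigma>: "\<sigma> \<subseteq> C" "\<And>S. S \<in> \<F> \<Longrightarrow> \<not> \<sigma> \<subseteq> t S" "x \<in> open_cell V a b \<sigma>"
      by (auto simp: \<Sigma>_def)
    have "x \<in> convex hull C" using cell_hull[OF \<sigma>(3) _ V(3)] \<sigma>(1) V(3) by blast
    moreover have "x \<notin> S" if "S \<in> \<F>" for S
      using cell_hull[OF \<sigma>(3), of "t S"] \<sigma>(1) \<sigma>(2)[OF that] t[OF that] V(3) calculation by blast
    ultimately show "x \<in> convex hull C - \<Union>\<F>" by blast
  qed
  then have eq: "convex hull C - \<Union>\<F> = (\<Union>\<sigma>\<in>\<Sigma>. open_cell V a b \<sigma>)" by blast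
  have "\<Sigma> \<subseteq> Pow V" using V(3) by (auto simp: \<Sigma>_def)
  moreover have "disjoint_family_on (open_cell V a b) \<Sigma>"
    unfolding disjoint_family_on_def using disj calculation by blast
  ultimately show thesis using that V(1,2) eq by blast
qed

section \<open>The Lebesgue constant\<close>

lemma cell_functional_bound:
  fixes V L :: "(real ^ 'n::finite) set" and n :: "real ^ 'n"
  assumes "0 < m" and A: "1 \<le> A"
    "\<And>(K :: (real ^ 'n) set) H c. finite K \<Longrightarrow> K \<subseteq> integer_vectors \<Longrightarrow> halfspace_like H \<Longrightarrow>
       (\<integral>x. cmod (trig_sum c (K \<inter> H) x) ^ (2 * m) \<partial>torus_measure)
       \<le> A * (\<integral>x. cmod (trig_sum c K x) ^ (2 * m) \<partial>torus_measure)"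
    and V: "finite V" and L: "finite L" "L \<subseteq> integer_vectors"
    and n: "\<And>j. 0 \<le> n $ j" and cell: "open_cell V a b \<sigma> \<subseteq> cbox 0 n"
  shows "cmod (\<Sum>k\<in>L \<inter> open_cell V a b \<sigma>. c k) ^ (2 * m) \<le>
    (real m ^ CARD('n) * (A ^ 2) ^ card V) * (\<Prod>j\<in>UNIV. (n $ j + 1)) * (\<integral>x. cmod (trig_sum c L x) ^ (2 * m) \<partial>torus_measure)"
proof -
  let ?Q = "L \<inter> open_cell V a b \<sigma>" and ?N = "\<Prod>j\<in>UNIV. (n $ j + 1)"
  have "cmod (\<Sum>k\<in>?Q. c k) ^ (2 * m)
      \<le> real m ^ CARD('n) * ?N * (\<integral>x. cmod (trig_sum c ?Q x) ^ (2 * m) \<partial>torus_measure)"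
    by (rule nikolskii_even[OF assms(1) n]) (use L cell in \<open>auto simp: lattice_points_eq\<close>)
  also have "\<dots> \<le> real m ^ CARD('n) * ?N * ((A ^ 2) ^ card V * (\<integral>x. cmod (trig_sum c L x) ^ (2 * m) \<partial>torus_measure))"
    by (intro mult_left_mono cell_projection_bounded[OF A V L] mult_nonneg_nonneg prod_nonneg)
       (use n in \<open>auto intro: add_nonneg_nonneg\<close>)
  finally show ?thesis by (simp add: mult_ac)
qed

text \<open>Adding the simplices one at a time, each contributes the part not covered before: the simplex minus
some of its faces, hence at most \<open>2 ^ (CARD('n) + 1)\<close> cells. The number of cells therefore grows
linearly with the size of the triangulation.\<close>

lemma triangulation_functional_bound:
  fixes L :: "(real ^ 'n::finite) set" and n :: "real ^ 'n"
  assumes m: "0 < m" and A: "1 \<le> A"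
    "\<And>(K :: (real ^ 'n) set) H c. finite K \<Longrightarrow> K \<subseteq> integer_vectors \<Longrightarrow> halfspace_like H \<Longrightarrow>
       (\<integral>x. cmod (trig_sum c (K \<inter> H) x) ^ (2 * m) \<partial>torus_measure)
       \<le> A * (\<integral>x. cmod (trig_sum c K x) ^ (2 * m) \<partial>torus_measure)"
    and L: "finite L" "L \<subseteq> integer_vectors"
    and n: "\<And>j. 0 \<le> n $ j"
    and T: "triangulation T" "\<Union>T \<subseteq> cbox 0 n"
  shows "cmod (\<Sum>k\<in>L \<inter> \<Union>T. c k) ^ (2 * m) \<le> (real (card T) * 2 ^ (CARD('n) + 1)) ^ (2 * m) *
    ((real m ^ CARD('n) * (A ^ 2) ^ (CARD('n) + 1)) * (\<Prod>j\<in>UNIV. (n $ j + 1)) * (\<integral>x. cmod (trig_sum c L x) ^ (2 * m) \<partial>torus_measure))"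
proof -
  define E where "E = (real m ^ CARD('n) * (A ^ 2) ^ (CARD('n) + 1)) * (\<Prod>j\<in>UNIV. (n $ j + 1)) * (\<integral>x. cmod (trig_sum c L x) ^ (2 * m) \<partial>torus_measure)"
  define R where "R = root (2 * m) E"
  have "0 \<le> E" unfolding E_def using n A(1) by (intro mult_nonneg_nonneg prod_nonneg) (auto intro: add_nonneg_nonneg)
  then have R: "0 \<le> R" "R ^ (2 * m) = E" using m by (auto simp: R_def)
  have "finite T" using T(1) by (simp add: triangulation_def)
  then have "cmod (\<Sum>k\<in>L \<inter> \<Union>T. c k) \<le> real (card T) * (2 ^ (CARD('n) + 1) * R)"
    using T
  proof (induction T rule: finite_induct)
    case empty
    then show ?case by simp
  next
    case (insert S T)
    obtain d where "d simplex S" using insert.prems(1) by (auto simp: triangulation_def)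
    then obtain C where C: "\<not> affine_dependent C" "S = convex hull C" by (auto simp: simplex_def)
    have faces: "(convex hull C \<inter> S') face_of convex hull C" if "S' \<in> T" for S'
      using insert.prems(1) that C(2) by (auto simp: triangulation_def)
    obtain V a b \<Sigma> where cells: "finite V" "card V = CARD('n) + 1" "\<Sigma> \<subseteq> Pow V"
      "S - \<Union>T = (\<Union>\<sigma>\<in>\<Sigma>. open_cell V a b \<sigma>)" "disjoint_family_on (open_cell V a b) \<Sigma>"
      using simplex_minus_faces_cells[OF C(1) faces] C(2) by metis
    have fin: "finite \<Sigma>" using cells(1,3) finite_subset by blast
    have "cmod (\<Sum>k\<in>L \<inter> open_cell V a b \<sigma>. c k) \<le> R" if "\<sigma> \<in> \<Sigma>" for \<sigma>
    proof -
      have "open_cell V a b \<sigma> \<subseteq> cbox 0 n" using that cells(4) insert.prems(2) by blast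
      from cell_functional_bound[OF m A cells(1) L n this, of c]
      have "cmod (\<Sum>k\<in>L \<inter> open_cell V a b \<sigma>. c k) ^ (2 * m) \<le> R ^ (2 * m)"
        unfolding R(2) E_def cells(2) .
      then show ?thesis using R(1) m by (simp add: power_mono_iff)
    qed
    then have "(\<Sum>\<sigma>\<in>\<Sigma>. cmod (\<Sum>k\<in>L \<inter> open_cell V a b \<sigma>. c k)) \<le> real (card \<Sigma>) * R"
      using sum_bounded_above[of \<Sigma> "\<lambda>\<sigma>. cmod (\<Sum>k\<in>L \<inter> open_cell V a b \<sigma>. c k)" R] by simp
    also have "real (card \<Sigma>) \<le> 2 ^ (CARD('n) + 1)"
    proof -
      have "card \<Sigma> \<le> card (Pow V)" using cells(1,3) by (intro card_mono) auto
      then have "card \<Sigma> \<le> 2 ^ (CARD('n) + 1)" by (simp add: card_Pow cells(1,2))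
      then have "real (card \<Sigma>) \<le> real (2 ^ (CARD('n) + 1))" by (simp only: of_nat_le_iff)
      then show ?thesis by simp
    qed
    finally have bound: "(\<Sum>\<sigma>\<in>\<Sigma>. cmod (\<Sum>k\<in>L \<inter> open_cell V a b \<sigma>. c k)) \<le> 2 ^ (CARD('n) + 1) * R"
      using R(1) by (simp add: mult_right_mono)
    have "L \<inter> (S - \<Union>T) = (\<Union>\<sigma>\<in>\<Sigma>. L \<inter> open_cell V a b \<sigma>)" unfolding cells(4) by blast
    moreover have "\<forall>\<sigma>\<in>\<Sigma>. \<forall>\<rho>\<in>\<Sigma>. \<sigma> \<noteq> \<rho> \<longrightarrow> (L \<inter> open_cell V a b \<sigma>) \<inter> (L \<inter> open_cell V a b \<rho>) = {}"
      using cells(5) unfolding disjoint_family_on_def by blast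
    ultimately have "(\<Sum>k\<in>L \<inter> (S - \<Union>T). c k) = (\<Sum>\<sigma>\<in>\<Sigma>. \<Sum>k\<in>L \<inter> open_cell V a b \<sigma>. c k)"
      using sum.UNION_disjoint[OF fin, of "\<lambda>\<sigma>. L \<inter> open_cell V a b \<sigma>" c] L(1) by simp
    then have new: "cmod (\<Sum>k\<in>L \<inter> (S - \<Union>T). c k) \<le> 2 ^ (CARD('n) + 1) * R"
      using norm_sum[of "\<lambda>\<sigma>. \<Sum>k\<in>L \<inter> open_cell V a b \<sigma>. c k" \<Sigma>] bound by simp
    have "L \<inter> \<Union>(insert S T) = (L \<inter> \<Union>T) \<union> (L \<inter> (S - \<Union>T))" by blast
    then have split: "(\<Sum>k\<in>L \<inter> \<Union>(insert S T). c k) = (\<Sum>k\<in>L \<inter> \<Union>T. c k) + (\<Sum>k\<in>L \<inter> (S - \<Union>T). c k)"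
      using L(1) by (simp only:) (rule sum.union_disjoint, auto)
    have "triangulation T" "\<Union>T \<subseteq> cbox 0 n"
      using insert.prems by (auto simp: triangulation_def)
    then have old: "cmod (\<Sum>k\<in>L \<inter> \<Union>T. c k) \<le> real (card T) * (2 ^ (CARD('n) + 1) * R)"
      by (rule insert.IH)
    have "cmod (\<Sum>k\<in>L \<inter> \<Union>(insert S T). c k) \<le> real (card T) * (2 ^ (CARD('n) + 1) * R) + 2 ^ (CARD('n) + 1) * R"
      unfolding split by (rule order_trans[OF norm_triangle_ineq add_mono[OF old new]])
    then show ?case using insert.hyps by (simp add: algebra_simps)
  qed
  then have "cmod (\<Sum>k\<in>L \<inter> \<Union>T. c k) ^ (2 * m) \<le> (real (card T) * (2 ^ (CARD('n) + 1) * R)) ^ (2 * m)"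
    by (intro power_mono) auto
  also have "\<dots> = (real (card T) * 2 ^ (CARD('n) + 1)) ^ (2 * m) * E"
    by (simp only: R(2)[symmetric] power_mult_distrib mult.assoc)
  finally show ?thesis unfolding E_def .
qed

lemma Lebesgue_const_eq:
  fixes W :: "(real ^ 'n::finite) set"
  assumes "0 < p"
  shows "Lebesgue_const p W = (\<integral>x. cmod (trig_sum (\<lambda>_. 1) (lattice_points W) x) powr p \<partial>torus_measure) powr (1 / p)"
proof -
  have "continuous_on UNIV (\<lambda>x. cmod (trig_sum (\<lambda>_. 1) (lattice_points W) x) powr p)"
    using assms by (intro continuous_on_powr' continuous_intros) auto
  then have "(\<integral>x. cmod (trig_sum (\<lambda>_. 1) (lattice_points W) x) powr p \<partial>torus_measure) = (1 / (2 * pi) ^ CARD('n)) *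
      (LINT x:torus_box|lborel. cmod (trig_sum (\<lambda>_. 1) (lattice_points W) x) powr p)"
    by (subst integral_torus_measure) (auto intro: borel_measurable_continuous_onI)
  then show ?thesis unfolding Lebesgue_const_def by (simp add: trig_sum_def cis_conv_exp)
qed

text \<open>The exponent \<open>2 * m / (2 * m - 1)\<close> tends to 1 as \<open>m\<close> grows, so some \<open>m\<close> places it at or below \<open>p\<close>. Since
the exponential sum is bounded by the number of lattice points, hence by \<open>N\<close>, the bound passes from
this exponent to \<open>p\<close> by estimating the surplus power of the modulus by the same power of \<open>N\<close>, which gives
exactly the power \<open>p - 1\<close> of \<open>N\<close>.\<close>

lemma Lebesgue_const_triangulation_bound:
  fixes p :: real
  assumes "1 < p"
  obtains C where "0 < C"
    "\<And>(P :: (real ^ 'n::finite) set) n s. (\<And>j. 1 \<le> n $ j) \<Longrightarrow> P \<subseteq> cbox 0 n \<Longrightarrow> has_triangulation_of_size P s \<Longrightarrow>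
       Lebesgue_const p P \<le> C * real s * (\<Prod>j\<in>UNIV. (n $ j + 1) powr (1 - 1 / p))"
proof -
  obtain m :: nat where m: "1 / (p - 1) < real m" using reals_Archimedean2 by blast
  have "0 < 1 / (p - 1)" using assms by simp
  then have m0: "0 < m" using m by (metis of_nat_0_less_iff less_trans)
  define r where "r = 1 / real (2 * m - 1)"
  have "1 / (p - 1) \<le> real (2 * m - 1)" using m m0 by (simp add: of_nat_diff)
  then have r: "0 < r" "r \<le> p - 1" "r * real (2 * m) = 1 + r" "r * real (2 * m - 1) = 1"
    using assms m0 by (auto simp: r_def field_simps of_nat_diff)
  obtain A where A: "1 \<le> A"
    "\<And>(K :: (real ^ 'n) set) H c. finite K \<Longrightarrow> K \<subseteq> integer_vectors \<Longrightarrow> halfspace_like H \<Longrightarrow>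
       (\<integral>x. cmod (trig_sum c (K \<inter> H) x) ^ (2 * m) \<partial>torus_measure)
       \<le> A * (\<integral>x. cmod (trig_sum c K x) ^ (2 * m) \<partial>torus_measure)"
    using halfspace_projection_bounded[OF m0] by metis
  define c0 where "c0 = real m ^ CARD('n) * (A ^ 2) ^ (CARD('n) + 1)"
  define C where "C = 2 ^ (CARD('n) + 1) * c0"
  have "1 \<le> real m ^ CARD('n)" "1 \<le> (A ^ 2) ^ (CARD('n) + 1)"
    using A(1) m0 by (intro one_le_power; simp)+
  then have c0: "1 \<le> c0"
    unfolding c0_def using mult_mono[of 1 "real m ^ CARD('n)" 1 "(A ^ 2) ^ (CARD('n) + 1)"] by simp
  moreover have "1 \<le> (2 :: real) ^ (CARD('n) + 1)" by (rule one_le_power) simp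
  ultimately have C: "1 \<le> C"
    unfolding C_def using mult_mono[of 1 "2 ^ (CARD('n) + 1)" 1 c0] by simp
  have "Lebesgue_const p P \<le> C * real s * (\<Prod>j\<in>UNIV. (n $ j + 1) powr (1 - 1 / p))"
    if n1: "\<And>j. 1 \<le> n $ j" and P: "P \<subseteq> cbox 0 n" "has_triangulation_of_size P s" for P :: "(real ^ 'n) set" and n s
  proof -
    obtain T where T: "triangulation T" "\<Union>T = P" "card T = s"
      using P(2) by (auto simp: has_triangulation_of_size_def triangulation_of_def)
    define N where "N = (\<Prod>j\<in>UNIV. (n $ j + 1))"
    define K where "K = lattice_points P"
    define I where "I = (\<integral>x. cmod (trig_sum (\<lambda>_. 1) K x) powr (1 + r) \<partial>torus_measure)"
    have n0: "0 \<le> n $ j" for j using n1[of j] by linarith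
    have N: "1 \<le> N" unfolding N_def using n0 by (intro prod_ge_1) simp
    have K: "K \<subseteq> lattice_points (cbox 0 n)" using P(1) by (auto simp: K_def lattice_points_def)
    have D_bound: "cmod (trig_sum (\<lambda>_. 1) K x) \<le> N" for x
    proof -
      have "cmod (trig_sum (\<lambda>_. 1) K x) \<le> real (card K)" using norm_trig_sum_le[of "\<lambda>_. 1" K x] by simp
      also have "\<dots> \<le> real (card (lattice_points (cbox 0 n)))"
        using card_mono[OF lattice_points_box(1)[OF n0] K] by simp
      also have "\<dots> \<le> N" unfolding N_def by (rule lattice_points_box(2)[OF n0])
      finally show ?thesis .
    qed
    show ?thesis
    proof (cases "s = 0")
      case True
      then have "P = {}" using T by (auto simp: triangulation_def)
      then show ?thesis using True assms by (simp add: Lebesgue_const_eq lattice_points_def trig_sum_def)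
    next
      case False
      have sC: "1 \<le> real s * C" using False C mult_mono[of 1 "real s" 1 C] by simp
      define G where "G = (real s * 2 ^ (CARD('n) + 1)) ^ (2 * m) * (c0 * N)"
      have G0: "0 \<le> G" using c0 N by (simp add: G_def)
      have "I ^ (2 * m - 1) \<le> G"
      proof -
        have "cmod (\<Sum>k\<in>K \<inter> L. c k) ^ (2 * m) \<le> G * (\<integral>x. cmod (trig_sum c L x) ^ (2 * m) \<partial>torus_measure)"
          if L: "finite L" "L \<subseteq> integer_vectors" for L c
        proof -
          have "K \<inter> L = L \<inter> \<Union>T" using L T(2) by (auto simp: K_def lattice_points_eq)
          then show ?thesis
            using triangulation_functional_bound[OF m0 A L n0 T(1), of c] P(1) T(2,3)
            by (simp add: G_def c0_def N_def mult.assoc)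
        qed
        from dual_norm_bound[OF m0 n0 K this G0]
        have "(\<integral>x. cmod (trig_sum (\<lambda>_. 1) K x) powr (real (2 * m) / real (2 * m - 1)) \<partial>torus_measure) ^ (2 * m - 1) \<le> G" .
        moreover have "real (2 * m) / real (2 * m - 1) = 1 + r"
          using m0 by (simp add: r_def field_simps of_nat_diff)
        ultimately show ?thesis by (simp only: I_def)
      qed
      also have "G \<le> (real s * C) ^ (2 * m) * N"
      proof -
        \<comment> \<open>Absorbing \<open>c0\<close> into the \<open>2 * m\<close>-th power keeps the dependence on \<open>s\<close> linear at the end.\<close>
        have "c0 \<le> c0 ^ (2 * m)" using c0 m0 by (intro self_le_power) auto
        then have "G \<le> (real s * 2 ^ (CARD('n) + 1)) ^ (2 * m) * (c0 ^ (2 * m) * N)"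
          unfolding G_def using N by (intro mult_left_mono mult_right_mono) auto
        also have "\<dots> = (real s * C) ^ (2 * m) * N"
          by (simp only: C_def power_mult_distrib mult.assoc)
        finally show ?thesis .
      qed
      finally have "(I ^ (2 * m - 1)) powr r \<le> ((real s * C) ^ (2 * m) * N) powr r"
        using r(1) by (intro powr_mono2) (auto simp: I_def)
      also have "(I ^ (2 * m - 1)) powr r = I"
      proof -
        have "0 \<le> I" by (simp add: I_def)
        then have "(I ^ (2 * m - 1)) powr r = (I powr real (2 * m - 1)) powr r"
          using m0 by (subst powr_realpow') auto
        also have "\<dots> = I powr (r * real (2 * m - 1))" by (simp only: powr_powr mult.commute)
        also have "\<dots> = I" unfolding r(4) using \<open>0 \<le> I\<close> by simp
        finally show ?thesis .
      qed
      also have "((real s * C) ^ (2 * m) * N) powr r = (real s * C) powr (1 + r) * N powr r"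
      proof -
        have "(real s * C) ^ (2 * m) = (real s * C) powr real (2 * m)"
          using sC by (intro powr_realpow[symmetric]) linarith
        then show ?thesis
          using N sC r(3) by (simp only: powr_mult powr_powr mult.commute[of _ r])
      qed
      finally have I: "I \<le> (real s * C) powr (1 + r) * N powr r" .
      have int: "integrable torus_measure (\<lambda>x. cmod (trig_sum (\<lambda>_. 1) K x) powr t)" if "0 < t" for t
        using D_bound that
        by (intro integrable_torus[where B = "N powr t"] continuous_on_powr' continuous_intros) (auto intro: powr_mono2)
      have "(\<integral>x. cmod (trig_sum (\<lambda>_. 1) K x) powr p \<partial>torus_measure)
          \<le> (\<integral>x. N powr (p - 1 - r) * cmod (trig_sum (\<lambda>_. 1) K x) powr (1 + r) \<partial>torus_measure)"
      proof (rule integral_mono)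
        fix x
        have "cmod (trig_sum (\<lambda>_. 1) K x) powr p
            = cmod (trig_sum (\<lambda>_. 1) K x) powr (p - 1 - r) * cmod (trig_sum (\<lambda>_. 1) K x) powr (1 + r)"
          by (simp add: powr_add[symmetric])
        also have "\<dots> \<le> N powr (p - 1 - r) * cmod (trig_sum (\<lambda>_. 1) K x) powr (1 + r)"
          using D_bound r by (intro mult_right_mono powr_mono2) auto
        finally show "cmod (trig_sum (\<lambda>_. 1) K x) powr p \<le> N powr (p - 1 - r) * cmod (trig_sum (\<lambda>_. 1) K x) powr (1 + r)" .
      qed (use assms r int in auto)
      also have "\<dots> = N powr (p - 1 - r) * I" by (simp add: I_def)
      also have "\<dots> \<le> N powr (p - 1 - r) * ((real s * C) powr (1 + r) * N powr r)"
        by (intro mult_left_mono I) simp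
      also have "\<dots> = (real s * C) powr (1 + r) * N powr (p - 1)"
        using N by (simp add: powr_add[symmetric])
      also have "\<dots> \<le> (real s * C) powr p * N powr (p - 1)"
        using sC r by (intro mult_right_mono powr_mono) auto
      finally have "Lebesgue_const p P \<le> ((real s * C) powr p * N powr (p - 1)) powr (1 / p)"
        using assms by (subst Lebesgue_const_eq) (auto simp: K_def[symmetric] intro!: powr_mono2)
      also have "\<dots> = (real s * C) * N powr (1 - 1 / p)"
      proof -
        have "(p - 1) * (1 / p) = 1 - 1 / p" using assms by (simp add: field_simps)
        then show ?thesis using C N assms by (simp add: powr_mult powr_powr)
      qed
      also have "N powr (1 - 1 / p) = (\<Prod>j\<in>UNIV. (n $ j + 1) powr (1 - 1 / p))"
        unfolding N_def by (rule prod_powr_distrib)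
      finally show ?thesis by (simp add: mult_ac)
    qed
  qed
  with that C show thesis by (metis less_le_trans zero_less_one)
qed

theorem theorem5p1:
  fixes p :: real
  assumes "1 < p"
  shows
    "(\<exists>C :: nat \<Rightarrow> real. (\<forall>s. 0 < C s) \<and>
        (\<forall>(P :: (real ^ 'd::finite) set) (n :: real ^ 'd) (s :: nat).
           polyhedron P \<and> bounded P \<and> (\<forall>j. 1 \<le> n $ j) \<and> P \<subseteq> cbox 0 n \<and>
           has_triangulation_of_size P s \<longrightarrow>
           Lebesgue_const p P \<le> C s * (\<Prod>j\<in>UNIV. (n $ j + 1) powr (1 - 1 / p)))) \<and>
     (\<exists>(C :: real) (N0 :: nat \<Rightarrow> real). 0 < C \<and>
        (\<forall>(P :: (real ^ 'd::finite) set) (n :: real ^ 'd) (s :: nat).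
           polyhedron P \<and> bounded P \<and> (\<forall>j. 1 \<le> n $ j) \<and> P \<subseteq> cbox 0 n \<and>
           has_triangulation_of_size P s \<and> N0 s \<le> (MIN j. n $ j) \<longrightarrow>
           Lebesgue_const p P \<le> C * real s * (\<Prod>j\<in>UNIV. (n $ j + 1) powr (1 - 1 / p))))"
proof -
  obtain C where C: "0 < C" and bound:
    "\<And>(P :: (real ^ 'd) set) n s. (\<And>j. 1 \<le> n $ j) \<Longrightarrow> P \<subseteq> cbox 0 n \<Longrightarrow> has_triangulation_of_size P s \<Longrightarrow>
       Lebesgue_const p P \<le> C * real s * (\<Prod>j\<in>UNIV. (n $ j + 1) powr (1 - 1 / p))"
    using Lebesgue_const_triangulation_bound[OF assms] by blast
  show ?thesis
  proof (intro conjI)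
    have "Lebesgue_const p P \<le> C * (real s + 1) * (\<Prod>j\<in>UNIV. (n $ j + 1) powr (1 - 1 / p))"
      if "\<forall>j. 1 \<le> n $ j" "P \<subseteq> cbox 0 n" "has_triangulation_of_size P s" for P :: "(real ^ 'd) set" and n s
    proof -
      have "Lebesgue_const p P \<le> C * real s * (\<Prod>j\<in>UNIV. (n $ j + 1) powr (1 - 1 / p))"
        using bound that by blast
      also have "\<dots> \<le> C * (real s + 1) * (\<Prod>j\<in>UNIV. (n $ j + 1) powr (1 - 1 / p))"
        using C by (intro mult_right_mono mult_left_mono prod_nonneg) auto
      finally show ?thesis .
    qed
    then show "\<exists>C :: nat \<Rightarrow> real. (\<forall>s. 0 < C s) \<and>
        (\<forall>(P :: (real ^ 'd::finite) set) (n :: real ^ 'd) (s :: nat).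
           polyhedron P \<and> bounded P \<and> (\<forall>j. 1 \<le> n $ j) \<and> P \<subseteq> cbox 0 n \<and>
           has_triangulation_of_size P s \<longrightarrow>
           Lebesgue_const p P \<le> C s * (\<Prod>j\<in>UNIV. (n $ j + 1) powr (1 - 1 / p)))"
      using C by (intro exI[of _ "\<lambda>s. C * (real s + 1)"]) (auto intro!: mult_pos_pos add_nonneg_pos)
    show "\<exists>(C :: real) (N0 :: nat \<Rightarrow> real). 0 < C \<and>
        (\<forall>(P :: (real ^ 'd::finite) set) (n :: real ^ 'd) (s :: nat).
           polyhedron P \<and> bounded P \<and> (\<forall>j. 1 \<le> n $ j) \<and> P \<subseteq> cbox 0 n \<and>
           has_triangulation_of_size P s \<and> N0 s \<le> (MIN j. n $ j) \<longrightarrow>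
           Lebesgue_const p P \<le> C * real s * (\<Prod>j\<in>UNIV. (n $ j + 1) powr (1 - 1 / p)))"
      using C bound by (intro exI[of _ C] exI[of _ "\<lambda>_. 0"]) blast
  qed
qed

end
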